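(* Let $1<q<p$, $\kappa\in(0,1]$, and let $x,y,z>0$ satisfy $$0<\frac{x^q}{\kappa^{q-1}}<y\le x^{\frac{p-q}{p-1}}\,z^{\frac{q-1}{p-1}} .$$ Put $s_1=\frac{x^p}{\kappa^{p-1}z}$ and $s_2=\frac{x^q}{\kappa^{q-1}y}$ (so that the condition $0<\frac{x^q}{\kappa^{q-1}}<y\le x^{\frac{p-q}{p-1}}\,z^{\frac{q-1}{p-1}}$ is equivalent to $0<s_1^{\frac{q-1}{p-1}}\le s_2<1$). Let $t(\beta)=t(\beta,s_1,s_2)$, $\beta\in[0,\frac1{p-1}]$, and $F_{s_1,s_2}$ be as defined in the context, and let $t(s_1,s_2)$ be the greatest element $t$ of $[1,t(0)]$ for which $F_{s_1,s_2}(t)\le 0$. Then for every non-increasing $L^p$-integrable function $h:(0,\kappa]\to\mathbb{R}^{+}$ with $\int_0^\kappa h=x$, $\int_0^\kappa h^q=y$ and $\int_0^\kappa h^p=z$, $$\int_0^\kappa\left(\frac1u\int_0^u h\right)^p du\;\le\; t(s_1,s_2)^p\int_0^\kappa h^p .$$ Moreover, for each such fixed $s_1,s_2$, $$t(s_1,s_2)=\min\left\{t(\beta)\;:\;\beta\in\left[0,\tfrac1{p-1}\right]\right\}.$$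
   Context: Here $\mathbb{R}^+$ denotes the non-negative reals. For $r>1$ let $H_r(w)=r w^{r-1}-(r-1)w^{r}$; it is a strictly decreasing bijection of $[1,\frac{r}{r-1}]$ onto $[0,1]$, and $\omega_r:[0,1]\to[1,\frac r{r-1}]$ denotes its inverse. Fix $1<q<p$ and $s_1,s_2$ with $0<s_1^{\frac{q-1}{p-1}}\le s_2<1$. For $\beta\in[0,\frac1{p-1}]$ put $G=G(\beta)=q(p-1)(\beta+1)-p(q-1)>0$, and let $t(\beta)=t(\beta,s_1,s_2)$ be the unique real number $t\ge 1$ satisfying $$t^p-\frac{p(\beta+1)^q}{G}\,t^{p-q}=\frac{p-q}{G}(\beta+1)\,s_1+\frac{s_1}{s_2}\left(\frac{p(q-1)\beta}{G}\,\omega_q(s_2)^q-\frac{p(\beta+1)^q}{G}\right).$$ Put $\alpha(s_2)=\frac{\omega_q(s_2)^q}{s_2}-1$ and, for $t\ge1$, $\tau(t)=\frac{p-q}{p}\cdot\frac{t^p-s_1}{t^{p-q}-\frac{s_1}{s_2}}$ (one has $s_1<s_2$, and $\tau(t)\in[0,1]$ for $t\in[1,t(0)]$). For $t\in[1,t(0)]$ define $$F_{s_1,s_2}(t)=q\left(p\,\omega_q(\tau(t))^{q-1}-(p-1)\,\omega_q(\tau(t))^{q}\right)\left(t^{p-q}-\frac{s_1}{s_2}\right)-(p-q)\,s_1\,\alpha(s_2).$$ *)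

theory Defs
  imports "HOL-Analysis.Analysis"
begin

definition H :: "real \<Rightarrow> real \<Rightarrow> real" where
  "H r w = r * w powr (r - 1) - (r - 1) * w powr r"

(* Only meaningful for arguments in {0..1}, which H r attains on {1..r / (r - 1)} when r > 1. *)
definition omega :: "real \<Rightarrow> real \<Rightarrow> real" where
  "omega r = inv_into {1..r / (r - 1)} (H r)"

definition G :: "real \<Rightarrow> real \<Rightarrow> real \<Rightarrow> real" where
  "G p q \<beta> = q * (p - 1) * (\<beta> + 1) - p * (q - 1)"

definition t_beta :: "real \<Rightarrow> real \<Rightarrow> real \<Rightarrow> real \<Rightarrow> real \<Rightarrow> real" where
  "t_beta p q s1 s2 \<beta> = (THE t. 1 \<le> t \<and>
     t powr p - p * (\<beta> + 1) powr q / G p q \<beta> * t powr (p - q) =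
       (p - q) / G p q \<beta> * (\<beta> + 1) * s1
       + s1 / s2 * (p * (q - 1) * \<beta> / G p q \<beta> * omega q s2 powr q
                    - p * (\<beta> + 1) powr q / G p q \<beta>))"

definition alpha :: "real \<Rightarrow> real \<Rightarrow> real" where
  "alpha q s2 = omega q s2 powr q / s2 - 1"

definition tau :: "real \<Rightarrow> real \<Rightarrow> real \<Rightarrow> real \<Rightarrow> real \<Rightarrow> real" where
  "tau p q s1 s2 t = (p - q) / p * ((t powr p - s1) / (t powr (p - q) - s1 / s2))"

definition F :: "real \<Rightarrow> real \<Rightarrow> real \<Rightarrow> real \<Rightarrow> real \<Rightarrow> real" where
  "F p q s1 s2 t =
     q * (p * omega q (tau p q s1 s2 t) powr (q - 1)
          - (p - 1) * omega q (tau p q s1 s2 t) powr q) * (t powr (p - q) - s1 / s2)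
     - (p - q) * s1 * alpha q s2"

definition admissible_t :: "real \<Rightarrow> real \<Rightarrow> real \<Rightarrow> real \<Rightarrow> real set" where
  "admissible_t p q s1 s2 = {t \<in> {1..t_beta p q s1 s2 0}. F p q s1 s2 t \<le> 0}"

definition t_max :: "real \<Rightarrow> real \<Rightarrow> real \<Rightarrow> real \<Rightarrow> real" where
  "t_max p q s1 s2 = (GREATEST t. t \<in> admissible_t p q s1 s2)"

end

theory Submission
  imports Defs
begin

text \<open>
  With \<open>avg u = 1/u * \<integral>\<^sub>0\<^sup>u h\<close> one has \<open>(u * avg u powr r)' = r * avg u powr (r - 1) * h u - (r - 1) * avg u powr r\<close>.
  Integrating this for \<open>r = p\<close> and \<open>r = q\<close>, and applying Young's inequality with parameter \<open>\<beta> + 1\<close> to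
  \<open>avg u powr (q - 1) * h u\<close> against the nonnegative weight \<open>avg u powr (p - q) - avg \<kappa> powr (p - q)\<close>,
  shows that \<open>t = (\<integral> avg\<^sup>p / z)\<^bsup>1/p\<^esup>\<close> satisfies \<open>level p q s1 s2 \<beta> t \<le> 0\<close>, i.e. \<open>t \<le> t_beta p q s1 s2 \<beta>\<close>,
  for every \<open>\<beta>\<close>.

  On the other hand, up to positive factors, the level function is the sum of a Young gap, vanishing
  exactly at \<open>\<beta> + 1 = omega q (tau p q s1 s2 t)\<close>, and of \<open>\<beta> * F p q s1 s2 t\<close>. Hence \<open>F p q s1 s2 t \<le> 0\<close> is
  equivalent to \<open>t \<le> t_beta p q s1 s2 \<beta>\<close> for all \<open>\<beta>\<close>, so that \<open>t_max\<close> is the minimum of \<open>t_beta\<close>.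
\<close>

subsection \<open>Young's inequality and the functions \<open>H\<close> and \<open>omega\<close>\<close>

text \<open>Young's inequality for the conjugate exponents \<open>r\<close> and
  \<open>r / (r - 1)\<close>, applied to \<open>a\<close> and \<open>c powr (r - 1)\<close>. It is
  sharp at \<open>a = c\<close>, and every estimate below that involves \<open>H\<close> or
  \<open>omega\<close> rests on this equality case.\<close>

lemma young_powr:
  fixes a c r :: real
  assumes "1 < r" "0 \<le> a" "0 \<le> c"
  shows "r * a * c powr (r - 1) \<le> a powr r + (r - 1) * c powr r"
proof -
  have "1 / r + 1 / (r / (r - 1)) = 1" "1 < r / (r - 1)"
    using assms by (simp_all add: field_simps)
  then have "a * c powr (r - 1) \<le> a powr r / r + (c powr (r - 1)) powr (r / (r - 1)) / (r / (r - 1))"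
    using assms by (intro Youngs_inequality) auto
  also have "(c powr (r - 1)) powr (r / (r - 1)) = c powr r"
    using assms by (simp add: powr_powr)
  finally show ?thesis
    using assms by (simp add: field_simps)
qed

text \<open>This is \<open>young_powr\<close> with exponent \<open>p / q\<close> at the points
  \<open>c powr q\<close> and \<open>a powr q\<close>, multiplied by \<open>q\<close>.\<close>

lemma young_powr_diff:
  fixes a c p q :: real
  assumes "0 < q" "q < p" "0 \<le> a" "0 \<le> c"
  shows "p * (a powr (p - q) * c powr q) \<le> (p - q) * a powr p + q * c powr p"
proof -
  have e: "q * (p / q - 1) = p - q" "q * (p / q) = p"
    using assms by (simp_all add: field_simps)
  have "(p / q) * c powr q * (a powr q) powr (p / q - 1)
      \<le> (c powr q) powr (p / q) + (p / q - 1) * (a powr q) powr (p / q)"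
    using assms by (intro young_powr) auto
  then have "q * ((p / q) * c powr q * (a powr q) powr (p / q - 1))
      \<le> q * ((c powr q) powr (p / q) + (p / q - 1) * (a powr q) powr (p / q))"
    using assms by (intro mult_left_mono) auto
  then show ?thesis
    using assms e by (simp add: powr_powr algebra_simps)
qed

lemma bernoulli_powr:
  fixes a r :: real
  assumes "1 < r" "0 \<le> a"
  shows "1 + r * (a - 1) \<le> a powr r"
  using young_powr[of r a 1] assms by (simp add: algebra_simps)

text \<open>The derivative of \<open>H r\<close> is
  \<open>r * (r - 1) * w powr (r - 2) * (1 - w)\<close>. Monotonicity is stated on all of
  \<open>[1, \<infinity>)\<close>, so that \<open>le_omega\<close> can handle points not known to
  lie below \<open>r / (r - 1)\<close>.\<close>

lemma H_strict_antimono: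
  assumes "1 < r" "1 \<le> u" "u < v"
  shows "H r v < H r u"
proof (rule DERIV_neg_imp_decreasing_open[OF \<open>u < v\<close>])
  fix w assume w: "u < w" "w < v"
  then have "1 < w" using assms by simp
  have e: "w powr (r - 1) = w * w powr (r - 2)"
    using \<open>1 < w\<close> powr_mult_base[of w "r - 2"] by simp
  have "(H r has_real_derivative r * ((r - 1) * w powr (r - 2)) - (r - 1) * (r * w powr (r - 1))) (at w)"
    unfolding H_def[abs_def]
    using \<open>1 < w\<close> by (auto intro!: derivative_eq_intros)
  moreover have "r * ((r - 1) * w powr (r - 2)) - (r - 1) * (r * w powr (r - 1))
      = r * (r - 1) * w powr (r - 2) * (1 - w)"
    unfolding e by (simp add: algebra_simps)
  moreover have "r * (r - 1) * w powr (r - 2) * (1 - w) < 0"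
    using assms \<open>1 < w\<close> by (intro mult_pos_neg mult_pos_pos) auto
  ultimately show "\<exists>y. (H r has_real_derivative y) (at w) \<and> y < 0" by metis
next
  show "continuous_on {u..v} (H r)"
    unfolding H_def[abs_def] using assms by (intro continuous_intros) auto
qed

text \<open>By the intermediate value theorem between \<open>H r 1 = 1\<close> and
  \<open>H r (r / (r - 1)) = 0\<close>, the value \<open>c\<close> is attained, so
  \<open>inv_into\<close> returns a genuine preimage.\<close>

lemma omega_inverse:
  assumes "1 < r" "0 \<le> c" "c \<le> 1"
  shows "1 \<le> omega r c" "H r (omega r c) = c"
proof -
  have "H r (r / (r - 1)) = 0"
  proof -
    have "(r / (r - 1)) powr r = r / (r - 1) * (r / (r - 1)) powr (r - 1)"
      using powr_mult_base[of "r / (r - 1)" "r - 1"] assms by simp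
    then show ?thesis using assms by (simp add: H_def field_simps)
  qed
  moreover have "H r 1 = 1" by (simp add: H_def)
  moreover have "1 \<le> r / (r - 1)" using assms by (simp add: field_simps)
  moreover have "continuous_on {1..r / (r - 1)} (H r)"
    unfolding H_def[abs_def] by (intro continuous_intros) auto
  ultimately have "\<exists>w\<ge>1. w \<le> r / (r - 1) \<and> H r w = c"
    using assms by (intro IVT2') auto
  then have "c \<in> H r ` {1..r / (r - 1)}" by auto
  then have "omega r c \<in> {1..r / (r - 1)}" "H r (omega r c) = c"
    unfolding omega_def by (rule inv_into_into, rule f_inv_into_f)
  then show "1 \<le> omega r c" "H r (omega r c) = c" by auto
qed

lemma le_omega:
  assumes "1 < r" "0 \<le> c" "c \<le> 1" "1 \<le> u" "c \<le> H r u"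
  shows "u \<le> omega r c"
  using H_strict_antimono[of r "omega r c" u] omega_inverse[of r c] assms by force

subsection \<open>The level function defining \<open>t_beta\<close>\<close>

text \<open>The equation defining \<open>t_beta\<close>, multiplied by \<open>G\<close> and with all
  terms brought to the left, so that \<open>t_beta\<close> becomes a root and its position is read
  off from a sign.\<close>

definition level :: "real \<Rightarrow> real \<Rightarrow> real \<Rightarrow> real \<Rightarrow> real \<Rightarrow> real \<Rightarrow> real" where
  "level p q s1 s2 \<beta> t =
     G p q \<beta> * t powr p - p * (\<beta> + 1) powr q * (t powr (p - q) - s1 / s2)
     - (p - q) * (\<beta> + 1) * s1 - s1 / s2 * (p * (q - 1) * \<beta> * omega q s2 powr q)"

lemma G_eq: "G p q \<beta> = p - q + q * (p - 1) * \<beta>"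
  by (simp add: G_def algebra_simps)

text \<open>\<open>G\<close> is affine in \<open>\<beta>\<close> and
  \<open>(\<beta> + 1) powr q\<close> is convex, so the two endpoints decide. At
  \<open>\<beta> = 0\<close> both sides equal \<open>p - q\<close>. At
  \<open>\<beta> = 1 / (p - 1)\<close> the claim is
  \<open>(p - q) * (p / (p - 1)) powr q \<le> p\<close>, which is Bernoulli's inequality for
  \<open>(1 - 1 / p) powr q\<close>.\<close>

lemma G_ge:
  assumes "1 < q" "q < p" "0 \<le> \<beta>" "\<beta> \<le> 1 / (p - 1)"
  shows "(p - q) * (\<beta> + 1) powr q \<le> G p q \<beta>"
proof -
  define l where "l = (p - 1) * \<beta>"
  define B where "B = (p / (p - 1)) powr q"
  have l: "0 \<le> l" "l \<le> 1" using assms by (auto simp: l_def pos_le_divide_eq mult.commute)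
  have "((1 - l) *\<^sub>R 1 + l *\<^sub>R (p / (p - 1))) powr q \<le> (1 - l) * 1 powr q + l * B"
    unfolding B_def using assms l
    by (intro convex_onD[OF powr_convex[of q]]) auto
  also have "(1 - l) *\<^sub>R 1 + l *\<^sub>R (p / (p - 1)) = \<beta> + 1"
    using assms by (simp add: l_def field_simps)
  finally have 1: "(\<beta> + 1) powr q \<le> (1 - l) + l * B" by simp
  have "1 + q * ((1 - 1 / p) - 1) \<le> (1 - 1 / p) powr q"
    using assms by (intro bernoulli_powr) auto
  then have "(p - q) / p \<le> (1 - 1 / p) powr q"
    using assms by (simp add: field_simps)
  also have "(1 - 1 / p) powr q = 1 / B"
    using assms by (simp add: B_def powr_divide field_simps)
  finally have 2: "(p - q) * B \<le> p"
    using assms by (simp add: B_def field_simps)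
  have "(p - q) * (\<beta> + 1) powr q \<le> (p - q) * ((1 - l) + l * B)"
    using assms 1 by (intro mult_left_mono) auto
  also have "\<dots> = (p - q) * (1 - l) + l * ((p - q) * B)" by (simp add: algebra_simps)
  also have "\<dots> \<le> (p - q) * (1 - l) + l * p"
    using 2 l by (intro add_left_mono mult_left_mono) auto
  also have "\<dots> = G p q \<beta>" by (simp add: l_def G_eq algebra_simps)
  finally show ?thesis .
qed

text \<open>The derivative is a positive multiple of
  \<open>G p q \<beta> * t powr q - (p - q) * (\<beta> + 1) powr q\<close>, and \<open>G_ge\<close>
  makes this positive for \<open>t > 1\<close>.\<close>

lemma level_strict_mono:
  assumes "1 < q" "q < p" "0 \<le> \<beta>" "\<beta> \<le> 1 / (p - 1)" "1 \<le> u" "u < v"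
  shows "level p q s1 s2 \<beta> u < level p q s1 s2 \<beta> v"
proof (rule DERIV_pos_imp_increasing_open[OF \<open>u < v\<close>])
  fix t assume t: "u < t" "t < v"
  then have "1 < t" using assms by simp
  have e: "t powr (p - 1) = t powr q * t powr (p - q - 1)"
    by (simp flip: powr_add)
  have "(level p q s1 s2 \<beta> has_real_derivative
      G p q \<beta> * (p * t powr (p - 1)) - p * (\<beta> + 1) powr q * ((p - q) * t powr (p - q - 1))) (at t)"
    unfolding level_def[abs_def]
    using \<open>1 < t\<close> by (auto intro!: derivative_eq_intros)
  moreover have "G p q \<beta> * (p * t powr (p - 1)) - p * (\<beta> + 1) powr q * ((p - q) * t powr (p - q - 1))
      = p * t powr (p - q - 1) * (G p q \<beta> * t powr q - (p - q) * (\<beta> + 1) powr q)"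
    unfolding e by (simp add: algebra_simps)
  moreover have "0 < p * t powr (p - q - 1) * (G p q \<beta> * t powr q - (p - q) * (\<beta> + 1) powr q)"
  proof -
    have "0 < (p - q) * (\<beta> + 1) powr q" using assms by simp
    then have "0 < G p q \<beta>" using G_ge[OF assms(1-4)] by linarith
    moreover have "1 < t powr q" using \<open>1 < t\<close> assms by simp
    ultimately have "G p q \<beta> < G p q \<beta> * t powr q" by simp
    then have "0 < G p q \<beta> * t powr q - (p - q) * (\<beta> + 1) powr q"
      using G_ge[OF assms(1-4)] by linarith
    then show ?thesis using assms \<open>1 < t\<close> by simp
  qed
  ultimately show "\<exists>y. (level p q s1 s2 \<beta> has_real_derivative y) (at t) \<and> 0 < y" by metis
next
  show "continuous_on {u..v} (level p q s1 s2 \<beta>)"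
    unfolding level_def[abs_def] using assms by (intro continuous_intros) auto
qed

section \<open>Consequences of the constraints on \<open>s1\<close> and \<open>s2\<close>, and
  existence of the root \<open>t_beta\<close>\<close>

locale parameters =
  fixes p q s1 s2 :: real
  assumes q: "1 < q" and pq: "q < p"
    and s1_pos: "0 < s1" and s1_s2: "s1 powr ((q - 1) / (p - 1)) \<le> s2" and s2_less: "s2 < 1"
begin

lemma s2_pos: "0 < s2"
  using s1_s2 s1_pos by (smt (verit) powr_gt_zero)

lemma s1_less: "s1 < 1"
proof (rule ccontr)
  assume "\<not> s1 < 1"
  then have "1 powr ((q - 1) / (p - 1)) \<le> s1 powr ((q - 1) / (p - 1))"
    using q pq by (intro powr_mono2) auto
  then show False using s1_s2 s2_less by simp
qed

text \<open>This says that \<open>level\<close> is nonpositive at \<open>\<beta> = 0\<close>,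
  \<open>t = 1\<close>. The constraint on \<open>s1\<close> and \<open>s2\<close> gives
  \<open>s1 / s2 \<le> a\<close>, where \<open>a powr ((p - 1) / (p - q)) = s1\<close>; Bernoulli's
  inequality for that power gives the bound with \<open>p - 1\<close> in place of
  \<open>p\<close>.\<close>

lemma ratio_bound: "(p - q) * (1 - s1) \<le> p * (1 - s1 / s2)"
proof -
  define a where "a = s1 powr ((p - q) / (p - 1))"
  have "s1 \<le> a * s2"
  proof -
    have "s1 = a * s1 powr ((q - 1) / (p - 1))"
      using q pq s1_pos by (simp add: a_def add_divide_distrib[symmetric] flip: powr_add)
    also have "\<dots> \<le> a * s2"
      using s1_s2 by (intro mult_left_mono) (auto simp: a_def)
    finally show ?thesis .
  qed
  then have r: "s1 / s2 \<le> a" using s2_pos by (simp add: field_simps)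
  have "1 + (p - 1) / (p - q) * (a - 1) \<le> a powr ((p - 1) / (p - q))"
    using q pq by (intro bernoulli_powr) (auto simp: a_def field_simps)
  also have "\<dots> = s1" using q pq s1_pos by (simp add: a_def powr_powr)
  finally have b: "(p - q) * (1 - s1) \<le> (p - 1) * (1 - a)"
    using q pq by (simp add: field_simps)
  have "0 \<le> (p - q) * (1 - s1)" using pq s1_less by simp
  with b have "0 \<le> 1 - a" using q pq by (smt (verit) mult_pos_neg)
  then have "(p - 1) * (1 - a) \<le> p * (1 - a)" by (simp add: mult_right_mono)
  also have "\<dots> \<le> p * (1 - s1 / s2)" using r q pq by simp
  finally show ?thesis using b by linarith
qed

lemma ratio_less: "s1 / s2 < 1"
proof -
  have "0 < (p - q) * (1 - s1)" using pq s1_less by simp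
  then have "0 < p * (1 - s1 / s2)" using ratio_bound by linarith
  then show ?thesis using q pq by (simp add: zero_less_mult_iff)
qed

abbreviation "w \<equiv> omega q s2"

lemma w_ge: "1 \<le> w" and H_w: "q * w powr (q - 1) - (q - 1) * w powr q = s2"
  using omega_inverse[of q s2] q s2_pos s2_less by (auto simp: H_def)

lemma alpha_nonneg: "0 \<le> alpha q s2"
proof -
  have "1 \<le> w powr q" using w_ge q by (simp add: ge_one_powr_ge_zero)
  then show ?thesis using s2_pos s2_less by (simp add: alpha_def field_simps)
qed

text \<open>Places 1 to the left of the root. Since \<open>w \<ge> 1\<close>, the equation
  \<open>H q w = s2\<close> bounds \<open>(q - 1) * w powr q\<close> below by \<open>q - s2\<close>.
  Bernoulli's inequality in the form \<open>M \<ge> 1\<close> then removes \<open>\<beta>\<close>,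
  and \<open>ratio_bound\<close> remains.\<close>

lemma level_one:
  assumes "0 \<le> \<beta>" "\<beta> \<le> 1 / (p - 1)"
  shows "level p q s1 s2 \<beta> 1 \<le> 0"
proof -
  define r where "r = s1 / s2"
  define M where "M = (\<beta> + 1) powr q - q * \<beta>"
  have r: "0 < r" "r < 1" and rs: "r * s2 = s1"
    using s1_pos s2_pos ratio_less by (auto simp: r_def)
  have "1 \<le> M"
    using bernoulli_powr[of q "\<beta> + 1"] q assms by (simp add: M_def)
  have "1 \<le> w powr (q - 1)" using w_ge q by (simp add: ge_one_powr_ge_zero)
  then have "q \<le> q * w powr (q - 1)" using q by simp
  then have "q - s2 \<le> (q - 1) * w powr q" using H_w by linarith
  then have "(p * \<beta> * r) * (q - s2) \<le> (p * \<beta> * r) * ((q - 1) * w powr q)"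
    using assms q pq r by (intro mult_left_mono) auto
  then have 1: "p * \<beta> * (r * q) - p * \<beta> * s1 \<le> r * (p * (q - 1) * \<beta> * w powr q)"
    by (simp add: algebra_simps flip: rs)
  have "level p q s1 s2 \<beta> 1
      \<le> G p q \<beta> - p * (\<beta> + 1) powr q * (1 - r) - (p - q) * (\<beta> + 1) * s1 - (p * \<beta> * (r * q) - p * \<beta> * s1)"
    using 1 by (simp add: level_def r_def)
  also have "\<dots> = - (p * M * (1 - r)) + (p - q * (\<beta> + 1)) * (1 - s1)"
    by (simp add: M_def G_def algebra_simps)
  also have "\<dots> \<le> - (p * 1 * (1 - r)) + (p - q) * (1 - s1)"
    using \<open>1 \<le> M\<close> r s1_less q pq assms by (intro add_mono) (auto intro!: mult_right_mono)
  also have "\<dots> \<le> 0" using ratio_bound by (simp add: r_def)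
  finally show ?thesis .
qed

lemma G_pos: "0 \<le> \<beta> \<Longrightarrow> 0 < G p q \<beta>"
  using q pq by (auto simp: G_eq intro!: add_pos_nonneg)

lemma t_beta_eq_level:
  assumes "0 \<le> \<beta>"
  shows "t_beta p q s1 s2 \<beta> = (THE t. 1 \<le> t \<and> level p q s1 s2 \<beta> t = 0)"
proof -
  have "t powr p - p * (\<beta> + 1) powr q / G p q \<beta> * t powr (p - q) =
       (p - q) / G p q \<beta> * (\<beta> + 1) * s1
       + s1 / s2 * (p * (q - 1) * \<beta> / G p q \<beta> * omega q s2 powr q
                    - p * (\<beta> + 1) powr q / G p q \<beta>) \<longleftrightarrow> level p q s1 s2 \<beta> t = 0" for t
  proof -
    define r where "r = s1 / s2"
    have "level p q s1 s2 \<beta> t / G p q \<beta> = (t powr p - p * (\<beta> + 1) powr q / G p q \<beta> * t powr (p - q))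
      - ((p - q) / G p q \<beta> * (\<beta> + 1) * s1
         + r * (p * (q - 1) * \<beta> / G p q \<beta> * omega q s2 powr q - p * (\<beta> + 1) powr q / G p q \<beta>))"
      using G_pos[OF assms] unfolding level_def by (fold r_def) (simp add: field_simps)
    then show ?thesis using G_pos[OF assms] unfolding r_def by (smt (verit) divide_eq_0_iff)
  qed
  then show ?thesis unfolding t_beta_def by simp
qed

lemma level_root:
  assumes "0 \<le> \<beta>" "\<beta> \<le> 1 / (p - 1)"
  shows "\<exists>!t. 1 \<le> t \<and> level p q s1 s2 \<beta> t = 0"
proof (rule ex_ex1I)
  \<comment> \<open>\<open>c\<close> collects the sizes of the terms subtracted in
    \<open>level\<close>, and \<open>T\<close> is chosen so that \<open>G p q \<beta> * T powr p =
    (G p q \<beta> + c) * T powr (p - q)\<close>. As \<open>T powr (p - q) \<ge> 1\<close>, this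
    outweighs them.\<close>
  define c where "c = p * (\<beta> + 1) powr q + (p - q) * (\<beta> + 1) * s1
     + s1 / s2 * (p * (q - 1) * \<beta> * w powr q)"
  have "0 \<le> c" using assms q pq s1_pos s2_pos by (simp add: c_def)
  define T where "T = (1 + c / G p q \<beta>) powr (1 / q)"
  have "1 \<le> T"
    unfolding T_def using \<open>0 \<le> c\<close> G_pos[OF assms(1)] q by (intro ge_one_powr_ge_zero) auto
  have Tq: "T powr q = 1 + c / G p q \<beta>"
    using \<open>0 \<le> c\<close> G_pos[OF assms(1)] q by (simp add: T_def powr_powr add_nonneg_nonneg)
  have "0 \<le> level p q s1 s2 \<beta> T"
  proof -
    have T1: "1 \<le> T powr (p - q)" using \<open>1 \<le> T\<close> pq by (simp add: ge_one_powr_ge_zero)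
    have "T powr p = T powr q * T powr (p - q)" by (simp flip: powr_add)
    then have "G p q \<beta> * T powr p = (G p q \<beta> + c) * T powr (p - q)"
      using G_pos[OF assms(1)] by (simp add: Tq field_simps)
    moreover have "0 \<le> G p q \<beta> * T powr (p - q)" using G_pos[OF assms(1)] by simp
    moreover have "0 \<le> c - p * (\<beta> + 1) powr q"
      using assms q pq s1_pos s2_pos by (simp add: c_def)
    then have "(c - p * (\<beta> + 1) powr q) * 1 \<le> (c - p * (\<beta> + 1) powr q) * T powr (p - q)"
      using T1 by (intro mult_left_mono)
    moreover have "0 \<le> p * (\<beta> + 1) powr q * (s1 / s2)"
      using q pq s1_pos s2_pos by simp
    ultimately show ?thesis
      unfolding level_def c_def by (simp add: algebra_simps)
  qed
  then have "\<exists>t\<ge>1. t \<le> T \<and> level p q s1 s2 \<beta> t = 0"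
    using level_one[OF assms] \<open>1 \<le> T\<close>
    by (intro IVT') (auto simp: level_def[abs_def] intro!: continuous_intros)
  then show "\<exists>t. 1 \<le> t \<and> level p q s1 s2 \<beta> t = 0" by blast
next
  show "t = t'" if "1 \<le> t \<and> level p q s1 s2 \<beta> t = 0" "1 \<le> t' \<and> level p q s1 s2 \<beta> t' = 0" for t t'
  proof (cases t t' rule: linorder_cases)
    case less
    then show ?thesis using level_strict_mono[OF q pq assms, of t t' s1 s2] that by simp
  next
    case greater
    then show ?thesis using level_strict_mono[OF q pq assms, of t' t s1 s2] that by simp
  qed
qed

lemma t_beta_root:
  assumes "0 \<le> \<beta>" "\<beta> \<le> 1 / (p - 1)"
  shows "1 \<le> t_beta p q s1 s2 \<beta>" "level p q s1 s2 \<beta> (t_beta p q s1 s2 \<beta>) = 0"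
  using theI'[OF level_root[OF assms]] by (simp_all add: t_beta_eq_level[OF assms(1)])

lemma le_t_beta_iff:
  assumes "0 \<le> \<beta>" "\<beta> \<le> 1 / (p - 1)" "1 \<le> t"
  shows "t \<le> t_beta p q s1 s2 \<beta> \<longleftrightarrow> level p q s1 s2 \<beta> t \<le> 0"
proof (cases t "t_beta p q s1 s2 \<beta>" rule: linorder_cases)
  case less
  then show ?thesis
    using level_strict_mono[OF q pq assms(1,2,3), of "t_beta p q s1 s2 \<beta>" s1 s2] t_beta_root[OF assms(1,2)]
    by simp
next
  case equal
  then show ?thesis using t_beta_root[OF assms(1,2)] by simp
next
  case greater
  then show ?thesis
    using level_strict_mono[OF q pq assms(1,2), of "t_beta p q s1 s2 \<beta>" t s1 s2] t_beta_root[OF assms(1,2)]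
    by simp
qed

section \<open>The sign of \<open>F\<close> compared with the signs of \<open>level\<close>, and the
  minimum of \<open>t_beta\<close>\<close>

lemma D_pos: "1 \<le> t \<Longrightarrow> 0 < t powr (p - q) - s1 / s2"
  using ratio_less ge_one_powr_ge_zero[of t "p - q"] pq by simp

text \<open>The upper bound is the inequality \<open>level p q s1 s2 0 t \<le> 0\<close> rearranged,
  so \<open>t \<le> t_beta p q s1 s2 0\<close> is what keeps \<open>tau\<close> in the domain of
  \<open>omega q\<close>.\<close>

lemma tau_range:
  assumes "1 \<le> t" "t \<le> t_beta p q s1 s2 0"
  shows "0 \<le> tau p q s1 s2 t" "tau p q s1 s2 t \<le> 1"
proof -
  have "1 \<le> t powr p" using assms q pq by (simp add: ge_one_powr_ge_zero)
  then show "0 \<le> tau p q s1 s2 t"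
    using D_pos[OF assms(1)] s1_less q pq unfolding tau_def
    by (intro mult_nonneg_nonneg divide_nonneg_pos) auto
  have "level p q s1 s2 0 t \<le> 0" using assms q pq by (subst le_t_beta_iff[symmetric]) auto
  then have "(p - q) * (t powr p - s1) \<le> p * (t powr (p - q) - s1 / s2)"
    by (simp add: level_def G_def algebra_simps)
  then show "tau p q s1 s2 t \<le> 1"
    using D_pos[OF assms(1)] q pq by (simp add: tau_def divide_le_eq mult.commute)
qed

text \<open>The relation \<open>H q v = tau p q s1 s2 t\<close> eliminates \<open>t powr p\<close>
  in favour of \<open>v powr (q - 1)\<close> and \<open>v powr q\<close>, and the definition of
  \<open>alpha\<close> eliminates \<open>omega q s2 powr q\<close>. What remains is a polynomial
  identity. The bracket with \<open>(\<beta> + 1) powr q\<close> is the negative of a Young gap and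
  vanishes at \<open>\<beta> + 1 = v\<close>.\<close>

lemma level_F:
  assumes "1 \<le> t" "t \<le> t_beta p q s1 s2 0"
  defines "v \<equiv> omega q (tau p q s1 s2 t)"
  shows "(p - q) * level p q s1 s2 \<beta> t =
    p * ((p - q) * (t powr (p - q) - s1 / s2)
           * (q * (\<beta> + 1) * v powr (q - 1) - (\<beta> + 1) powr q - (q - 1) * v powr q)
         + (q - 1) * \<beta> * F p q s1 s2 t)"
proof -
  define r where "r = s1 / s2"
  define D where "D = t powr (p - q) - r"
  define X Y where "X = v powr (q - 1)" and "Y = v powr q"
  define a where "a = alpha q s2"
  have "D > 0" using D_pos[OF assms(1)] by (simp add: D_def r_def)
  have "q * X - (q - 1) * Y = tau p q s1 s2 t"
    using omega_inverse(2)[of q "tau p q s1 s2 t"] tau_range[OF assms(1,2)] q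
    unfolding H_def X_def Y_def v_def by simp
  also have "\<dots> = (p - q) / p * ((t powr p - s1) / D)" by (simp add: tau_def D_def r_def)
  finally have 1: "(p - q) * t powr p = (p - q) * s1 + p * D * (q * X - (q - 1) * Y)"
    using \<open>D > 0\<close> q pq by (simp add: field_simps)
  have 2: "r * w powr q = s1 * (a + 1)" by (simp add: r_def a_def alpha_def)
  have "(p - q) * level p q s1 s2 \<beta> t
      = G p q \<beta> * ((p - q) * t powr p) - (p - q) * (p * (\<beta> + 1) powr q * D)
        - (p - q) * (p - q) * (\<beta> + 1) * s1 - (p - q) * (p * (q - 1) * \<beta> * (r * w powr q))"
    unfolding level_def by (fold r_def, fold D_def) (simp add: algebra_simps)
  also have "\<dots> = p * ((p - q) * D * (q * (\<beta> + 1) * X - (\<beta> + 1) powr q - (q - 1) * Y)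
         + (q - 1) * \<beta> * (q * (p * X - (p - 1) * Y) * D - (p - q) * s1 * a))"
    unfolding 1 2 G_def by (simp add: algebra_simps)
  also have "q * (p * X - (p - 1) * Y) * D - (p - q) * s1 * a = F p q s1 s2 t"
    by (simp add: F_def X_def Y_def D_def v_def a_def r_def)
  finally show ?thesis by (simp add: D_def X_def Y_def r_def)
qed

text \<open>If \<open>F\<close> is nonpositive, so are both summands in \<open>level_F\<close>. If
  \<open>F\<close> is positive, the choice \<open>\<beta> = v - 1\<close> closes the Young gap and
  leaves a positive multiple of \<open>F\<close>, except when \<open>v = 1\<close>, where the factor
  \<open>\<beta>\<close> vanishes too.\<close>

lemma F_nonpos_iff:
  assumes "1 \<le> t" "t \<le> t_beta p q s1 s2 0"
  shows "F p q s1 s2 t \<le> 0 \<longleftrightarrow> (\<forall>\<beta>\<in>{0..1 / (p - 1)}. t \<le> t_beta p q s1 s2 \<beta>)"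
proof -
  define v where "v = omega q (tau p q s1 s2 t)"
  define D where "D = t powr (p - q) - s1 / s2"
  have D: "0 < D" using D_pos[OF assms(1)] by (simp add: D_def)
  have v: "1 \<le> v"
    using omega_inverse(1)[of q "tau p q s1 s2 t"] tau_range[OF assms] q by (simp add: v_def)
  have level: "(p - q) * level p q s1 s2 \<beta> t =
      p * ((p - q) * D * (q * (\<beta> + 1) * v powr (q - 1) - (\<beta> + 1) powr q - (q - 1) * v powr q)
         + (q - 1) * \<beta> * F p q s1 s2 t)" for \<beta>
    using level_F[OF assms] by (simp add: v_def D_def)
  have "\<forall>\<beta>\<in>{0..1 / (p - 1)}. level p q s1 s2 \<beta> t \<le> 0" if "F p q s1 s2 t \<le> 0"
  proof
    fix \<beta> assume "\<beta> \<in> {0..1 / (p - 1)}"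
    then have "q * (\<beta> + 1) * v powr (q - 1) - (\<beta> + 1) powr q - (q - 1) * v powr q \<le> 0"
      using young_powr[of q "\<beta> + 1" v] q v by simp
    then have "(p - q) * level p q s1 s2 \<beta> t \<le> 0"
      unfolding level using q pq D that \<open>\<beta> \<in> _\<close>
      by (intro mult_nonneg_nonpos add_nonpos_nonpos) auto
    then show "level p q s1 s2 \<beta> t \<le> 0" using pq by (simp add: mult_le_0_iff)
  qed
  moreover have "\<exists>\<beta>\<in>{0..1 / (p - 1)}. 0 < level p q s1 s2 \<beta> t" if F: "0 < F p q s1 s2 t"
  proof (cases "v = 1")
    case True
    \<comment> \<open>The Young gap vanishes to first order at \<open>\<beta> = 0\<close>, so the
      term linear in \<open>F\<close> decides the sign for small positive
      \<open>\<beta>\<close>.\<close>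
    define f where "f = (\<lambda>\<beta>. (p - q) * D * (q * (\<beta> + 1) - (\<beta> + 1) powr q - (q - 1)) + (q - 1) * \<beta> * F p q s1 s2 t)"
    have "(f has_real_derivative (q - 1) * F p q s1 s2 t) (at 0)"
      unfolding f_def by (auto intro!: derivative_eq_intros)
    moreover have "0 < (q - 1) * F p q s1 s2 t" using F q by simp
    ultimately obtain d where d: "d > 0" "\<And>\<beta>. 0 < \<beta> \<Longrightarrow> \<beta> < d \<Longrightarrow> f 0 < f \<beta>"
      using DERIV_pos_inc_right[of f _ 0] by auto
    define \<beta> where "\<beta> = min (d / 2) (1 / (p - 1))"
    have b: "0 < \<beta>" "\<beta> < d" "\<beta> \<in> {0..1 / (p - 1)}" using d q pq by (auto simp: \<beta>_def)
    then have "0 < f \<beta>" using d(2)[of \<beta>] by (simp add: f_def)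
    moreover have "(p - q) * level p q s1 s2 \<beta> t = p * f \<beta>"
      unfolding level f_def True by simp
    ultimately have "0 < (p - q) * level p q s1 s2 \<beta> t" using q pq by simp
    then show ?thesis using b pq by (auto simp: zero_less_mult_iff)
  next
    case False
    then have v: "1 < v" using v by simp
    have vq: "v powr q = v * v powr (q - 1)" using powr_mult_base[of v "q - 1"] v by simp
    \<comment> \<open>Positivity of \<open>F\<close> with \<open>alpha \<ge> 0\<close> forces
      \<open>v < p / (p - 1)\<close>, so \<open>v - 1\<close> is a permitted value of
      \<open>\<beta>\<close>.\<close>
    have "0 \<le> (p - q) * s1 * alpha q s2" using pq s1_pos alpha_nonneg by simp
    then have "0 < q * (p * v powr (q - 1) - (p - 1) * v powr q) * D"
      using F by (simp add: F_def v_def D_def)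
    then have "0 < p * v powr (q - 1) - (p - 1) * v powr q"
      using q D by (simp add: zero_less_mult_iff)
    then have "0 < (p - (p - 1) * v) * v powr (q - 1)" unfolding vq by (simp add: algebra_simps)
    then have "(p - 1) * v < p" using v by (simp add: zero_less_mult_iff)
    then have "v - 1 \<le> 1 / (p - 1)" using q pq by (simp add: field_simps)
    moreover have "(p - q) * level p q s1 s2 (v - 1) t = p * ((q - 1) * (v - 1) * F p q s1 s2 t)"
      unfolding level by (simp add: vq algebra_simps)
    then have "0 < (p - q) * level p q s1 s2 (v - 1) t" using q pq F v by simp
    then have "0 < level p q s1 s2 (v - 1) t" using pq by (simp add: zero_less_mult_iff)
    ultimately show ?thesis using v by (intro bexI[of _ "v - 1"]) auto
  qed
  ultimately have "F p q s1 s2 t \<le> 0 \<longleftrightarrow> (\<forall>\<beta>\<in>{0..1 / (p - 1)}. level p q s1 s2 \<beta> t \<le> 0)"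
    by (meson not_less)
  then show ?thesis using le_t_beta_iff assms(1) by auto
qed

text \<open>The zero set \<open>S\<close> of \<open>level\<close> in a compact rectangle is compact
  and nonempty, so the coordinate \<open>t\<close> has a minimum on it; by uniqueness of roots this
  is a value of \<open>t_beta\<close>. Parameters whose root leaves the rectangle have
  \<open>t_beta\<close> above its value at 0, hence above the minimum.\<close>

lemma t_beta_attains_min:
  "\<exists>\<beta>\<in>{0..1 / (p - 1)}. \<forall>\<gamma>\<in>{0..1 / (p - 1)}. t_beta p q s1 s2 \<beta> \<le> t_beta p q s1 s2 \<gamma>"
proof -
  define B where "B = {0..1 / (p - 1)} \<times> {1..t_beta p q s1 s2 0}"
  define S where "S = {x \<in> B. level p q s1 s2 (fst x) (snd x) = 0}"
  have p1: "0 \<le> 1 / (p - 1)" using q pq by simp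
  have "closed S"
    unfolding S_def
  proof (rule continuous_closed_preimage_constant)
    show "continuous_on B (\<lambda>x. level p q s1 s2 (fst x) (snd x))"
      unfolding level_def G_def B_def by (intro continuous_intros) auto
    show "closed B" unfolding B_def by (intro closed_Times) auto
  qed
  moreover have "compact B" unfolding B_def by (intro compact_Times) auto
  ultimately have "compact (B \<inter> S)" by (rule compact_Int_closed[rotated])
  moreover have "B \<inter> S = S" by (auto simp: S_def)
  ultimately have "compact S" by simp
  moreover have "(0, t_beta p q s1 s2 0) \<in> S"
    using t_beta_root[of 0] p1 by (simp add: S_def B_def)
  ultimately have "\<exists>x\<in>S. \<forall>y\<in>S. snd x \<le> snd y"
    by (intro continuous_attains_inf continuous_intros) auto
  then obtain x where x: "x \<in> S" "\<forall>y\<in>S. snd x \<le> snd y" by blast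
  have root: "snd y = t_beta p q s1 s2 (fst y)" if "y \<in> S" for y
  proof -
    have "0 \<le> fst y" "fst y \<le> 1 / (p - 1)" "1 \<le> snd y" "level p q s1 s2 (fst y) (snd y) = 0"
      using that unfolding S_def B_def by (auto simp only: mem_Collect_eq mem_Times_iff atLeastAtMost_iff)
    then show ?thesis
      using level_root t_beta_root by blast
  qed
  have "t_beta p q s1 s2 (fst x) \<le> t_beta p q s1 s2 \<gamma>" if g: "\<gamma> \<in> {0..1 / (p - 1)}" for \<gamma>
  proof (cases "t_beta p q s1 s2 \<gamma> \<le> t_beta p q s1 s2 0")
    case True
    then have "(\<gamma>, t_beta p q s1 s2 \<gamma>) \<in> S"
      using t_beta_root[of \<gamma>] g by (simp add: S_def B_def)
    then have "snd x \<le> t_beta p q s1 s2 \<gamma>" using x(2) by (metis snd_conv)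
    then show ?thesis using root[OF x(1)] by simp
  next
    case False
    have "snd x \<le> t_beta p q s1 s2 0" using x(1) by (simp add: S_def B_def mem_Times_iff)
    then show ?thesis using False root[OF x(1)] by simp
  qed
  moreover have "fst x \<in> {0..1 / (p - 1)}" using x(1) by (simp add: S_def B_def mem_Times_iff)
  ultimately show ?thesis by blast
qed

lemma admissible_t_iff:
  "t \<in> admissible_t p q s1 s2 \<longleftrightarrow> 1 \<le> t \<and> (\<forall>\<beta>\<in>{0..1 / (p - 1)}. t \<le> t_beta p q s1 s2 \<beta>)"
  using F_nonpos_iff[of t] q pq by (auto simp: admissible_t_def)

text \<open>By \<open>admissible_t_iff\<close> the admissible set is the interval from 1 to the
  minimum of \<open>t_beta\<close>, so that minimum is the element picked by
  \<open>GREATEST\<close>.\<close>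

lemma t_max_properties:
  shows t_max_admissible: "t_max p q s1 s2 \<in> admissible_t p q s1 s2"
    and t_max_greatest: "t \<in> admissible_t p q s1 s2 \<Longrightarrow> t \<le> t_max p q s1 s2"
    and t_max_attained: "t_max p q s1 s2 \<in> t_beta p q s1 s2 ` {0..1 / (p - 1)}"
    and t_max_le: "\<beta> \<in> {0..1 / (p - 1)} \<Longrightarrow> t_max p q s1 s2 \<le> t_beta p q s1 s2 \<beta>"
proof -
  obtain \<beta>0 where b0: "\<beta>0 \<in> {0..1 / (p - 1)}"
      "\<forall>\<gamma>\<in>{0..1 / (p - 1)}. t_beta p q s1 s2 \<beta>0 \<le> t_beta p q s1 s2 \<gamma>"
    using t_beta_attains_min by blast
  have adm: "t_beta p q s1 s2 \<beta>0 \<in> admissible_t p q s1 s2"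
    using b0 t_beta_root[of \<beta>0] by (simp add: admissible_t_iff)
  have max: "t \<le> t_beta p q s1 s2 \<beta>0" if "t \<in> admissible_t p q s1 s2" for t
    using that b0 by (auto simp: admissible_t_iff)
  have eq: "t_max p q s1 s2 = t_beta p q s1 s2 \<beta>0"
    unfolding t_max_def by (rule Greatest_equality) (use adm max in auto)
  show "t_max p q s1 s2 \<in> admissible_t p q s1 s2" using adm eq by simp
  show "t \<in> admissible_t p q s1 s2 \<Longrightarrow> t \<le> t_max p q s1 s2" using max eq by simp
  show "t_max p q s1 s2 \<in> t_beta p q s1 s2 ` {0..1 / (p - 1)}" using b0 eq by simp
  show "\<beta> \<in> {0..1 / (p - 1)} \<Longrightarrow> t_max p q s1 s2 \<le> t_beta p q s1 s2 \<beta>" using b0 eq by simp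
qed

lemma le_t_max:
  assumes "1 \<le> t" "\<And>\<beta>. 0 \<le> \<beta> \<Longrightarrow> \<beta> \<le> 1 / (p - 1) \<Longrightarrow> level p q s1 s2 \<beta> t \<le> 0"
  shows "t \<le> t_max p q s1 s2"
  using assms t_max_greatest[of t] le_t_beta_iff by (auto simp: admissible_t_iff)

end

subsection \<open>Integration on half-open intervals\<close>

lemma le_of_nonneg_deriv_off_countable:
  fixes f :: "real \<Rightarrow> real"
  assumes "a \<le> b" and cont: "continuous_on {a..b} f" and C: "countable C"
    and deriv: "\<And>x. x \<in> {a<..<b} - C \<Longrightarrow> \<exists>y. (f has_real_derivative y) (at x) \<and> 0 \<le> y"
  shows "f a \<le> f b"
proof (rule ccontr)
  assume less: "\<not> f a \<le> f b"
  then have "a < b" using assms(1) by (cases "a = b") auto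
  \<comment> \<open>The slope \<open>e\<close> uses up only half of the supposed drop of
    \<open>f\<close>, so \<open>g\<close> still descends from \<open>a\<close> to \<open>b\<close>
    while its derivative off \<open>C\<close> is at least \<open>e\<close>.\<close>
  define e where "e = (f a - f b) / 2 / (b - a)"
  have e: "0 < e" using less \<open>a < b\<close> by (simp add: e_def)
  define g where "g = (\<lambda>x. f x + e * (x - a))"
  have gb: "g b < g a"
  proof -
    have "e * (b - a) = (f a - f b) / 2"
      using \<open>a < b\<close> nonzero_eq_divide_eq[of "b - a" e "(f a - f b) / 2"] by (simp only: e_def) simp
    then show ?thesis using less by (simp add: g_def)
  qed
  have contg: "continuous_on {a..b} g" unfolding g_def by (intro continuous_intros cont)
  \<comment> \<open>A countable set of values can be avoided; at the last point where \<open>g\<close> takes the value \<open>c\<close>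
    its derivative is positive, although \<open>g < c\<close> to the right of it.\<close>
  have "\<not> {g b<..<g a} \<subseteq> g ` C"
    using gb C uncountable_open_interval[of "g b" "g a"] by (meson countable_image countable_subset)
  then obtain c where c: "g b < c" "c < g a" "c \<notin> g ` C"
    by (meson greaterThanLessThan_iff subsetI)
  define S where "S = {x \<in> {a..b}. c \<le> g x}"
  have "closed S"
    unfolding S_def using continuous_closed_preimage[OF contg, of "{c..}"] by (simp add: vimage_def Int_def)
  then have "compact ({a..b} \<inter> S)" by (intro compact_Int_closed) auto
  moreover have "{a..b} \<inter> S = S" by (auto simp: S_def)
  ultimately have "compact S" by simp
  moreover have "a \<in> S" using c \<open>a < b\<close> by (simp add: S_def)
  ultimately obtain s where s: "s \<in> S" "\<And>x. x \<in> S \<Longrightarrow> x \<le> s"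
    using compact_attains_sup[of S] by auto
  have "s < b" using s c by (cases "s = b") (auto simp: S_def)
  have after: "g x < c" if "s < x" "x \<le> b" for x
    using s(2)[of x] s(1) that by (force simp: S_def)
  have "g s = c"
  proof (rule antisym)
    have "\<exists>x\<ge>s. x \<le> b \<and> g x = c"
      using s c by (intro IVT2' continuous_on_subset[OF contg]) (auto simp: S_def)
    then obtain x where x: "s \<le> x" "x \<le> b" "g x = c" by blast
    then have "x = s" using after[of x] by (cases "x = s") auto
    then show "g s \<le> c" using x by simp
  qed (use s in \<open>simp add: S_def\<close>)
  then have "s \<in> {a<..<b} - C" using c s \<open>s < b\<close> by (auto simp: S_def less_le)
  then obtain y where "(f has_real_derivative y) (at s)" "0 \<le> y" using deriv by blast
  then have "(g has_real_derivative y + e) (at s)"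
    unfolding g_def by (auto intro!: derivative_eq_intros)
  then obtain d where d: "d > 0" "\<And>h. 0 < h \<Longrightarrow> h < d \<Longrightarrow> g s < g (s + h)"
    using DERIV_pos_inc_right[of g "y + e" s] \<open>0 \<le> y\<close> e by auto
  define h where "h = min (d / 2) (b - s)"
  have "0 < h" "h < d" "s + h \<le> b" using d \<open>s < b\<close> by (auto simp: h_def)
  then show False using d(2)[of h] after[of "s + h"] \<open>g s = c\<close> by simp
qed

text \<open>Needed because a monotone \<open>h\<close> may be discontinuous at countably many
  points. Off \<open>C\<close> both \<open>f\<close> and the indefinite integral of
  \<open>f'\<close> have derivative \<open>f'\<close>, so their difference is monotone in both
  directions.\<close>

lemma fundamental_theorem_of_calculus_off_countable:
  fixes f f' :: "real \<Rightarrow> real"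
  assumes "a \<le> b" and cont: "continuous_on {a..b} f" and C: "countable C"
    and deriv: "\<And>x. x \<in> {a<..<b} - C \<Longrightarrow> (f has_real_derivative f' x) (at x)"
    and cont': "\<And>x. x \<in> {a<..<b} - C \<Longrightarrow> isCont f' x"
    and int: "f' integrable_on {a..b}"
  shows "(f' has_integral (f b - f a)) {a..b}"
proof -
  define I where "I = (\<lambda>x. integral {a..x} f')"
  have contI: "continuous_on {a..b} I"
    unfolding I_def by (rule indefinite_integral_continuous_1[OF int])
  have derivI: "(I has_real_derivative f' x) (at x)" if "x \<in> {a<..<b} - C" for x
  proof -
    have "(I has_vector_derivative f' x) (at x within {a..b} - {})"
      unfolding I_def using that cont'[OF that]
      by (intro integral_has_vector_derivative_continuous_at int)
        (auto intro: continuous_at_imp_continuous_within)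
    then show ?thesis
      using that at_within_interior[of x "{a..b}"]
      by (simp add: has_real_derivative_iff_has_vector_derivative)
  qed
  have "f a - I a \<le> f b - I b"
    by (rule le_of_nonneg_deriv_off_countable[OF \<open>a \<le> b\<close> _ C])
      (auto intro!: continuous_intros cont contI derivative_eq_intros exI[of _ 0] deriv derivI)
  moreover have "I a - f a \<le> I b - f b"
    by (rule le_of_nonneg_deriv_off_countable[OF \<open>a \<le> b\<close> _ C])
      (auto intro!: continuous_intros cont contI derivative_eq_intros exI[of _ 0] deriv derivI)
  moreover have "I a = 0" by (simp add: I_def)
  ultimately have "I b = f b - f a" by simp
  then show ?thesis using int unfolding I_def by (simp add: has_integral_integrable_integral)
qed

text \<open>Truncations to \<open>[\<epsilon> k, b]\<close> increase because \<open>f\<close> is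
  nonnegative, so monotone convergence applies; integrability near 0 is a conclusion.\<close>

lemma has_integral_nonneg_improper:
  fixes f g :: "real \<Rightarrow> real"
  assumes "0 < b" and nonneg: "\<And>x. 0 < x \<Longrightarrow> x \<le> b \<Longrightarrow> 0 \<le> f x"
    and int: "\<And>\<epsilon>. 0 < \<epsilon> \<Longrightarrow> \<epsilon> < b \<Longrightarrow> (f has_integral (g b - g \<epsilon>)) {\<epsilon>..b}"
    and lim: "(g \<longlongrightarrow> l) (at_right 0)"
  shows "(f has_integral (g b - l)) {0<..b}"
proof -
  \<comment> \<open>The double \<open>Suc\<close> makes \<open>\<epsilon> 0 = b / 2\<close>,
    strictly below \<open>b\<close> as the hypothesis on \<open>f\<close> requires.\<close>
  define \<epsilon> where "\<epsilon> = (\<lambda>k. b * inverse (real (Suc (Suc k))))"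
  have eps: "0 < \<epsilon> k" "\<epsilon> k < b" "\<epsilon> (Suc k) \<le> \<epsilon> k" for k
    using assms(1) by (auto simp: \<epsilon>_def field_simps add_pos_nonneg)
  have eps0: "\<epsilon> \<longlonglongrightarrow> 0"
    unfolding \<epsilon>_def by (rule tendsto_mult_right_zero[OF LIMSEQ_Suc[OF LIMSEQ_inverse_real_of_nat]])
  define F where "F = (\<lambda>k x. if x \<in> {\<epsilon> k..b} then f x else 0)"
  have F: "(F k has_integral (g b - g (\<epsilon> k))) {0<..b}" for k
    unfolding F_def using int[OF eps(1,2)] eps(1)[of k]
    by (subst has_integral_restrict) (auto intro: less_le_trans)
  have "filterlim \<epsilon> (at_right 0) sequentially"
    using eps0 eps(1) by (auto simp: filterlim_at less_imp_neq[symmetric] intro!: always_eventually)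
  then have glim: "(\<lambda>k. g b - g (\<epsilon> k)) \<longlonglongrightarrow> g b - l"
    by (intro tendsto_intros filterlim_compose[OF lim])
  have "f integrable_on {0<..b} \<and> (\<lambda>k. integral {0<..b} (F k)) \<longlonglongrightarrow> integral {0<..b} f"
  proof (rule monotone_convergence_increasing)
    show "F k integrable_on {0<..b}" for k using F by blast
    show "F k x \<le> F (Suc k) x" if "x \<in> {0<..b}" for k x
      using that nonneg[of x] eps(3)[of k] by (auto simp: F_def)
    show "(\<lambda>k. F k x) \<longlonglongrightarrow> f x" if "x \<in> {0<..b}" for x
    proof (rule tendsto_eventually)
      have "\<forall>\<^sub>F k in sequentially. \<epsilon> k < x" using order_tendstoD(2)[OF eps0, of x] that by simp
      then show "\<forall>\<^sub>F k in sequentially. F k x = f x"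
        by eventually_elim (use that in \<open>auto simp: F_def\<close>)
    qed
    show "bounded (range (\<lambda>k. integral {0<..b} (F k)))"
      using integral_unique[OF F] convergent_imp_bounded[OF glim] by simp
  qed
  moreover have "(\<lambda>k. integral {0<..b} (F k)) \<longlonglongrightarrow> g b - l"
    using integral_unique[OF F] glim by simp
  ultimately have "f integrable_on {0<..b}" "integral {0<..b} f = g b - l"
    using LIMSEQ_unique by blast+
  then show ?thesis using has_integral_integrable_integral by blast
qed

text \<open>A nonnegative gauge-integrable function is absolutely integrable for Lebesgue measure,
  and Borel measurability carries this over to \<open>lborel\<close>.\<close>

lemma set_integrable_lborel_nonneg:
  fixes f :: "real \<Rightarrow> real"
  assumes S: "S \<in> sets borel" and f: "f integrable_on S" "f \<in> borel_measurable (restrict_space borel S)"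
    and "\<And>x. x \<in> S \<Longrightarrow> 0 \<le> f x"
  shows "set_integrable lborel S f"
proof -
  have "set_integrable lebesgue S f"
    using nonnegative_absolutely_integrable_1[OF f(1)] assms(4) by blast
  moreover have "(\<lambda>x. indicator S x *\<^sub>R f x) \<in> borel_measurable lborel"
    using f(2) S by (simp add: borel_measurable_restrict_space_iff)
  ultimately show ?thesis unfolding set_integrable_def by (simp add: integrable_completion)
qed

lemma set_integrable_Ioc_imp_integrable_on_Icc:
  fixes f :: "real \<Rightarrow> real"
  assumes "set_integrable lborel {a<..b} f"
  shows "f integrable_on {a..b}"
proof -
  have "negligible ({a<..b} - {a..b} \<union> ({a..b} - {a<..b}))"
    by (rule negligible_subset[of "{a}"]) auto
  then show ?thesis
    using set_borel_integral_eq_integral(1)[OF assms] by (simp add: integrable_spike_set_eq)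
qed

lemma set_integral_Ioc_eq_integral_Icc:
  fixes f :: "real \<Rightarrow> real"
  assumes "set_integrable lborel {a<..b} f"
  shows "(LBINT u:{a<..b}. f u) = integral {a..b} f"
proof -
  have "(LBINT u:{a<..b}. f u) = integral {a<..b} f"
    by (rule set_borel_integral_eq_integral(2)[OF assms])
  also have "\<dots> = integral {a..b} f"
    by (rule integral_spike_set) (auto intro: negligible_subset[of "{a}"])
  finally show ?thesis .
qed

text \<open>On a bounded interval \<open>1 + f u powr p\<close> is an integrable majorant.
  Measurability of \<open>f u powr q\<close> is obtained by raising \<open>f u powr p\<close> to the
  power \<open>q / p\<close>.\<close>

lemma set_integrable_powr_le:
  fixes f :: "real \<Rightarrow> real"
  assumes "0 < q" "q \<le> p" and nonneg: "\<And>u. u \<in> {a<..b} \<Longrightarrow> 0 \<le> f u"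
    and int: "set_integrable lborel {a<..b} (\<lambda>u. f u powr p)"
  shows "set_integrable lborel {a<..b} (\<lambda>u. f u powr q)"
proof (rule set_integrable_bound)
  have "set_integrable lborel {a<..b} (\<lambda>_. 1 :: real)"
    by (cases "a \<le> b") (simp_all add: set_integrable_def)
  then show "set_integrable lborel {a<..b} (\<lambda>u. 1 + f u powr p)"
    using int by (rule set_integral_add(1))
  have "(\<lambda>u. (indicator {a<..b} u *\<^sub>R f u powr p) powr (q / p)) \<in> borel_measurable borel"
    using borel_measurable_integrable[OF int[unfolded set_integrable_def]] by measurable
  moreover have "(indicator {a<..b} u *\<^sub>R f u powr p) powr (q / p) = indicator {a<..b} u *\<^sub>R f u powr q" for u
    using assms(1,2) by (cases "u \<in> {a<..b}") (simp_all add: powr_powr)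
  ultimately show "set_borel_measurable lborel {a<..b} (\<lambda>u. f u powr q)"
    by (simp add: set_borel_measurable_def)
  have "f u powr q \<le> 1 + f u powr p" if "u \<in> {a<..b}" for u
  proof (cases "f u \<le> 1")
    case True
    then have "f u powr q \<le> 1 powr q" using nonneg[OF that] assms(1) by (intro powr_mono2) auto
    then show ?thesis by (simp add: add_increasing2)
  next
    case False
    then have "f u powr q \<le> f u powr p" using assms(2) by (intro powr_mono) auto
    then show ?thesis by simp
  qed
  then show "AE u in lborel. u \<in> {a<..b} \<longrightarrow> norm (f u powr q) \<le> norm (1 + f u powr p)"
    by (intro AE_I2 impI) simp
qed

subsection \<open>Averages of a decreasing function\<close>

locale decreasing_function =
  fixes h :: "real \<Rightarrow> real" and \<kappa> :: real
  assumes \<kappa>: "0 < \<kappa>"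
    and h_nonneg: "\<And>u. u \<in> {0<..\<kappa>} \<Longrightarrow> 0 \<le> h u"
    and h_anti: "antimono_on {0<..\<kappa>} h"
    and h_int: "set_integrable lborel {0<..\<kappa>} h"
    and x_pos: "0 < (LBINT u:{0<..\<kappa>}. h u)"
begin

definition avg :: "real \<Rightarrow> real" where
  "avg u = 1 / u * (LBINT v:{0<..u}. h v)"

lemma h_le: "\<lbrakk>0 < u; u \<le> v; v \<le> \<kappa>\<rbrakk> \<Longrightarrow> h v \<le> h u"
  using h_anti by (auto simp: monotone_on_def)

lemma h_integrable: "h integrable_on {0..\<kappa>}"
  by (rule set_integrable_Ioc_imp_integrable_on_Icc[OF h_int])

lemma h_set_integrable: "u \<le> \<kappa> \<Longrightarrow> set_integrable lborel {0<..u} h"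
  by (rule set_integrable_subset[OF h_int]) auto

lemma avg_eq: "0 < u \<Longrightarrow> u \<le> \<kappa> \<Longrightarrow> avg u = integral {0..u} h / u"
  by (simp add: avg_def set_integral_Ioc_eq_integral_Icc[OF h_set_integrable])

lemma const_set_integral:
  fixes c :: real
  assumes "0 \<le> u"
  shows "set_integrable lborel {0<..u} (\<lambda>_. c)" "(LBINT v:{0<..u}. c) = c * u"
  using assms by (simp_all add: set_integrable_def set_lebesgue_integral_def)

lemma h_le_avg:
  assumes "0 < u" "u \<le> \<kappa>"
  shows "h u \<le> avg u"
proof -
  have "(LBINT v:{0<..u}. h u) \<le> (LBINT v:{0<..u}. h v)"
    using assms by (intro set_integral_mono const_set_integral(1) h_set_integrable) (auto intro: h_le)
  then show ?thesis using assms const_set_integral(2)[of u "h u"] by (simp add: avg_def pos_le_divide_eq)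
qed

text \<open>Beyond \<open>u\<close> the values of \<open>h\<close> are at most
  \<open>h u \<le> avg u\<close>, so extending the interval cannot raise the average.\<close>

lemma avg_antimono:
  assumes "0 < u" "u \<le> v" "v \<le> \<kappa>"
  shows "avg v \<le> avg u"
proof -
  have int: "h integrable_on {0..v}" "h integrable_on {u..v}"
    using assms by (auto intro: integrable_on_subinterval[OF h_integrable])
  have "integral {u..v} h \<le> integral {u..v} (\<lambda>_. h u)"
    using assms int by (intro integral_le) (auto intro: h_le)
  also have "\<dots> = h u * (v - u)" using assms by simp
  also have "\<dots> \<le> avg u * (v - u)" using h_le_avg[of u] assms by (intro mult_right_mono) auto
  finally have "integral {u..v} h \<le> avg u * (v - u)" .
  moreover have "integral {0..u} h = avg u * u" using avg_eq[of u] assms by simp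
  moreover have "integral {0..v} h = avg v * v" using avg_eq[of v] assms by simp
  moreover have "integral {0..u} h + integral {u..v} h = integral {0..v} h"
    using assms int by (intro Henstock_Kurzweil_Integration.integral_combine) auto
  ultimately have "avg v * v \<le> avg u * v" by (simp add: algebra_simps)
  then show ?thesis using assms by simp
qed

lemma avg_ge: "0 < u \<Longrightarrow> u \<le> \<kappa> \<Longrightarrow> avg \<kappa> \<le> avg u"
  using avg_antimono[of u \<kappa>] by simp

lemma avg_pos: "0 < u \<Longrightarrow> u \<le> \<kappa> \<Longrightarrow> 0 < avg u"
proof -
  have "0 < avg \<kappa>" using x_pos \<kappa> by (simp add: avg_def)
  then show "0 < u \<Longrightarrow> u \<le> \<kappa> \<Longrightarrow> 0 < avg u" using avg_ge[of u] by linarith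
qed

lemma continuous_on_avg: "continuous_on {0<..\<kappa>} avg"
proof -
  have "continuous_on {0<..\<kappa>} (\<lambda>u. integral {0..u} h / u)"
    by (intro continuous_intros continuous_on_subset[OF indefinite_integral_continuous_1[OF h_integrable]]) auto
  then show ?thesis by (rule continuous_on_eq) (simp add: avg_eq)
qed

lemma avg_deriv:
  assumes "u \<in> {0<..<\<kappa>}" "isCont h u"
  shows "(avg has_real_derivative (h u - avg u) / u) (at u)"
proof -
  have "((\<lambda>u. integral {0..u} h) has_vector_derivative h u) (at u within {0..\<kappa>} - {})"
    using assms by (intro integral_has_vector_derivative_continuous_at h_integrable)
      (auto intro: continuous_at_imp_continuous_within)
  then have d: "((\<lambda>u. integral {0..u} h) has_real_derivative h u) (at u)"
    using assms at_within_interior[of u "{0..\<kappa>}"]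
    by (simp add: has_real_derivative_iff_has_vector_derivative)
  have "((\<lambda>u. integral {0..u} h / u) has_real_derivative (h u * u - integral {0..u} h * 1) / (u * u)) (at u)"
    using assms by (intro DERIV_divide d DERIV_ident) auto
  also have "(h u * u - integral {0..u} h * 1) / (u * u) = (h u - avg u) / u"
    using assms by (simp add: avg_eq field_simps)
  finally show ?thesis
    by (rule has_field_derivative_transform_within_open[of _ _ _ "{0<..<\<kappa>}"])
      (use assms in \<open>auto simp: avg_eq\<close>)
qed

lemma measurable_restrict [measurable]:
  "h \<in> borel_measurable (restrict_space borel {0<..\<kappa>})"
  "avg \<in> borel_measurable (restrict_space borel {0<..\<kappa>})"
proof -
  show "h \<in> borel_measurable (restrict_space borel {0<..\<kappa>})"
    using h_int borel_measurable_integrable[of lborel "\<lambda>x. indicator {0<..\<kappa>} x *\<^sub>R h x"]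
    by (simp add: set_integrable_def borel_measurable_restrict_space_iff)
qed (intro borel_measurable_continuous_on_restrict continuous_on_avg)

lemma set_integrable_dominated:
  fixes f g :: "real \<Rightarrow> real"
  assumes "set_integrable lborel S g" "S \<in> sets borel" "S \<subseteq> {0<..\<kappa>}"
    and "f \<in> borel_measurable (restrict_space borel {0<..\<kappa>})"
    and "\<And>u. u \<in> S \<Longrightarrow> \<bar>f u\<bar> \<le> g u"
  shows "set_integrable lborel S f"
proof (rule set_integrable_bound[OF assms(1)])
  have "f \<in> borel_measurable (restrict_space borel S)"
    by (rule measurable_restrict_mono[OF assms(4,3)])
  then show "set_borel_measurable lborel S f"
    using assms(2) by (simp add: set_borel_measurable_def borel_measurable_restrict_space_iff)
  show "AE x in lborel. x \<in> S \<longrightarrow> norm (f x) \<le> norm (g x)"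
  proof (intro AE_I2 impI)
    show "norm (f x) \<le> norm (g x)" if "x \<in> S" for x
      using assms(5)[OF that] by simp
  qed
qed

text \<open>Jensen's inequality, by integrating the tangent inequality \<open>young_powr\<close> at
  the average. It controls the boundary term at 0 in \<open>hardy\<close>.\<close>

lemma powr_set_integral_ge:
  assumes r: "1 < r" and int: "set_integrable lborel {0<..\<kappa>} (\<lambda>u. h u powr r)"
    and u: "0 < u" "u \<le> \<kappa>"
  shows "u * avg u powr r \<le> (LBINT v:{0<..u}. h v powr r)"
proof -
  define a where "a = avg u"
  have a: "0 < a" using avg_pos u by (simp add: a_def)
  have e: "a * a powr (r - 1) = a powr r" using powr_mult_base[of a "r - 1"] a by simp
  have x: "(LBINT v:{0<..u}. h v) = u * a" using u by (simp add: a_def avg_def)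
  have i1: "set_integrable lborel {0<..u} (\<lambda>v. r * a powr (r - 1) * h v)"
    using h_set_integrable[OF u(2)] by simp
  have "(LBINT v:{0<..u}. r * a powr (r - 1) * h v - (r - 1) * a powr r) \<le> (LBINT v:{0<..u}. h v powr r)"
  proof (rule set_integral_mono)
    show "set_integrable lborel {0<..u} (\<lambda>v. r * a powr (r - 1) * h v - (r - 1) * a powr r)"
      using u by (intro set_integral_diff(1) i1 const_set_integral(1)) simp
    show "set_integrable lborel {0<..u} (\<lambda>v. h v powr r)"
      using u by (intro set_integrable_subset[OF int]) auto
    show "r * a powr (r - 1) * h v - (r - 1) * a powr r \<le> h v powr r" if "v \<in> {0<..u}" for v
      using young_powr[OF r, of "h v" a] h_nonneg[of v] that u a by (simp add: algebra_simps)
  qed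
  also have "(LBINT v:{0<..u}. r * a powr (r - 1) * h v - (r - 1) * a powr r)
      = r * a powr (r - 1) * (u * a) - (r - 1) * a powr r * u"
    using u i1 const_set_integral[of u "(r - 1) * a powr r"] x
    by (subst set_integral_diff(2)) auto
  also have "\<dots> = u * a powr r" by (simp add: algebra_simps flip: e)
  finally show ?thesis by (simp add: a_def)
qed

text \<open>The integrand is the derivative of \<open>u * avg u powr r\<close> wherever
  \<open>h\<close> is continuous, that is, off a countable set. Staying away from 0 keeps it
  bounded, since there \<open>h u \<le> avg u \<le> avg \<epsilon>\<close>.\<close>

lemma hardy_FTC:
  assumes r: "1 < r" and \<epsilon>: "0 < \<epsilon>" "\<epsilon> < \<kappa>"
  shows "((\<lambda>u. r * (avg u powr (r - 1) * h u) - (r - 1) * avg u powr r)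
    has_integral (\<kappa> * avg \<kappa> powr r - \<epsilon> * avg \<epsilon> powr r)) {\<epsilon>..\<kappa>}"
proof (rule fundamental_theorem_of_calculus_off_countable[where f = "\<lambda>u. u * avg u powr r"])
  define C where "C = {u \<in> {0<..<\<kappa>}. \<not> isCont h u}"
  have "countable {u \<in> {0<..<\<kappa>}. \<not> isCont (\<lambda>u. - h u) u}"
    by (rule mono_on_ctble_discont_open) (auto simp: monotone_on_def intro: h_le)
  then show "countable C"
    unfolding C_def by (rule countable_subset[rotated]) (use continuous_minus in fastforce)
  have cont: "isCont h u" if "u \<in> {\<epsilon><..<\<kappa>} - C" for u
    using that \<epsilon> by (auto simp: C_def)
  have contA: "isCont avg u" if "u \<in> {\<epsilon><..<\<kappa>}" for u
    using continuous_on_avg that \<epsilon>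
    by (auto intro: continuous_on_interior)
  show "continuous_on {\<epsilon>..\<kappa>} (\<lambda>u. u * avg u powr r)"
  proof (intro continuous_intros continuous_on_subset[OF continuous_on_avg])
    show "\<forall>u\<in>{\<epsilon>..\<kappa>}. avg u \<noteq> 0"
      using \<epsilon> avg_pos by (metis atLeastAtMost_iff less_le_trans less_irrefl)
  qed (use \<epsilon> in auto)
  show "((\<lambda>u. u * avg u powr r) has_real_derivative
      r * (avg u powr (r - 1) * h u) - (r - 1) * avg u powr r) (at u)"
    if u: "u \<in> {\<epsilon><..<\<kappa>} - C" for u
  proof -
    have pos: "0 < avg u" "0 < u" using u \<epsilon> avg_pos[of u] by auto
    have d: "(avg has_real_derivative (h u - avg u) / u) (at u)"
      using u \<epsilon> by (intro avg_deriv cont) auto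
    have e: "avg u powr r = avg u * avg u powr (r - 1)"
      using powr_mult_base[of "avg u" "r - 1"] pos by simp
    have "((\<lambda>u. u * avg u powr r) has_real_derivative
        1 * avg u powr r + (r * avg u powr (r - 1) * ((h u - avg u) / u)) * u) (at u)"
      using DERIV_fun_powr[OF d pos(1), of r] by (intro DERIV_mult DERIV_ident) simp
    also have "1 * avg u powr r + (r * avg u powr (r - 1) * ((h u - avg u) / u)) * u
        = r * (avg u powr (r - 1) * h u) - (r - 1) * avg u powr r"
      using pos by (simp add: e field_simps)
    finally show ?thesis .
  qed
  show "isCont (\<lambda>u. r * (avg u powr (r - 1) * h u) - (r - 1) * avg u powr r) u"
    if "u \<in> {\<epsilon><..<\<kappa>} - C" for u
    using that \<epsilon> avg_pos[of u] by (intro continuous_intros cont contA) auto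
  show "(\<lambda>u. r * (avg u powr (r - 1) * h u) - (r - 1) * avg u powr r) integrable_on {\<epsilon>..\<kappa>}"
  proof (rule set_borel_integral_eq_integral(1)[OF set_integrable_dominated])
    define M where "M = r * avg \<epsilon> powr r + (r - 1) * avg \<epsilon> powr r"
    show "set_integrable lborel {\<epsilon>..\<kappa>} (\<lambda>_. M)" using \<epsilon> by (simp add: set_integrable_def)
    show "(\<lambda>u. r * (avg u powr (r - 1) * h u) - (r - 1) * avg u powr r)
        \<in> borel_measurable (restrict_space borel {0<..\<kappa>})"
      by measurable
    show "\<bar>r * (avg u powr (r - 1) * h u) - (r - 1) * avg u powr r\<bar> \<le> M" if "u \<in> {\<epsilon>..\<kappa>}" for u
    proof -
      have u: "0 < u" "u \<le> \<kappa>" "\<epsilon> \<le> u" using that \<epsilon> by auto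
      have "avg u powr (r - 1) * h u \<le> avg u powr (r - 1) * avg u"
        using h_le_avg u by (intro mult_left_mono) auto
      also have "\<dots> = avg u powr r"
        using powr_mult_base[of "avg u" "r - 1"] avg_pos[of u] u by (simp add: mult.commute)
      finally have 1: "avg u powr (r - 1) * h u \<le> avg u powr r" .
      have 2: "avg u powr r \<le> avg \<epsilon> powr r"
        using avg_antimono[of \<epsilon> u] avg_pos[of u] u \<epsilon> r by (intro powr_mono2) auto
      have "r * (avg u powr (r - 1) * h u) \<le> r * avg \<epsilon> powr r"
        using 1 2 r by (intro mult_left_mono) auto
      moreover have "(r - 1) * avg u powr r \<le> (r - 1) * avg \<epsilon> powr r"
        using 2 r by (intro mult_left_mono) auto
      moreover have "0 \<le> r * (avg u powr (r - 1) * h u)" "0 \<le> (r - 1) * avg u powr r"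
        using r h_nonneg u by auto
      ultimately show ?thesis unfolding M_def by linarith
    qed
  qed (use \<epsilon> in auto)
qed (use \<epsilon> in auto)

text \<open>The identity is \<open>hardy_FTC\<close> in the limit
  \<open>\<epsilon> \<rightarrow> 0\<close>.\<close>

lemma hardy:
  assumes r: "1 < r" and int: "set_integrable lborel {0<..\<kappa>} (\<lambda>u. h u powr r)"
  shows avg_powr_integrable: "set_integrable lborel {0<..\<kappa>} (\<lambda>u. avg u powr r)"
    and avg_powr_mult_integrable: "set_integrable lborel {0<..\<kappa>} (\<lambda>u. avg u powr (r - 1) * h u)"
    and hardy_identity: "(r - 1) * (LBINT u:{0<..\<kappa>}. avg u powr r) + \<kappa> * avg \<kappa> powr r
      = r * (LBINT u:{0<..\<kappa>}. avg u powr (r - 1) * h u)"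
proof -
  \<comment> \<open>\<open>C\<close> comes from Young's inequality for \<open>k * h u\<close> and
    \<open>c * avg u\<close> with \<open>c powr r = 1 / 2\<close> and
    \<open>k * c powr (r - 1) = 1\<close>, hence \<open>k powr r = C\<close>. This scaling absorbs
    the mixed term and leaves half of \<open>(r - 1) * avg u powr r\<close>.\<close>
  define C where "C = (2::real) powr (r - 1)"
  define J where "J = (\<lambda>u. integral {0..u} (\<lambda>v. h v powr r))"
  define f where "f = (\<lambda>u. C * h u powr r - (r * (avg u powr (r - 1) * h u) - (r - 1) * avg u powr r))"
  define g where "g = (\<lambda>u. C * J u - u * avg u powr r)"
  have intJ: "(\<lambda>v. h v powr r) integrable_on {0..\<kappa>}"
    by (rule set_integrable_Ioc_imp_integrable_on_Icc[OF int])
  have f_ge: "(r - 1) / 2 * avg u powr r \<le> f u" if "u \<in> {0<..\<kappa>}" for u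
  proof -
    define c where "c = (2::real) powr (- 1 / r)"
    have "0 < c" by (simp add: c_def)
    have c: "c powr r = 1 / 2"
    proof -
      have "c powr r = 2 powr (- 1)" unfolding c_def powr_powr using r by simp
      then show ?thesis by (simp add: powr_minus_divide)
    qed
    define k where "k = (2::real) powr ((r - 1) / r)"
    have "0 < k" by (simp add: k_def)
    have k: "k powr r = C" "k * c powr (r - 1) = 1"
    proof -
      have "k powr r = 2 powr ((r - 1) / r * r)" by (simp only: k_def powr_powr)
      then show "k powr r = C" using r by (simp add: C_def)
      have "k * c powr (r - 1) = 2 powr ((r - 1) / r + - 1 / r * (r - 1))"
        by (simp only: k_def c_def powr_powr powr_add)
      then show "k * c powr (r - 1) = 1" by simp
    qed
    have A: "0 < avg u" "0 \<le> h u" using that avg_pos h_nonneg by auto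
    have "r * (k * h u) * (c * avg u) powr (r - 1) \<le> (k * h u) powr r + (r - 1) * (c * avg u) powr r"
      using A \<open>0 < c\<close> \<open>0 < k\<close> by (intro young_powr r) auto
    then have "r * (k * c powr (r - 1)) * (avg u powr (r - 1) * h u) \<le> C * h u powr r + (r - 1) * (1 / 2 * avg u powr r)"
      using A \<open>0 < c\<close> \<open>0 < k\<close> by (simp add: powr_mult c k(1) mult_ac)
    then show ?thesis unfolding k f_def by (simp add: field_simps)
  qed
  \<comment> \<open>Adding \<open>C * h u powr r\<close> makes the integrand nonnegative and dominating \<open>avg u powr r\<close>, so the
    integrability of the latter is a consequence of the improper integral below.\<close>
  have "(f has_integral (g \<kappa> - 0)) {0<..\<kappa>}"
  proof (rule has_integral_nonneg_improper[OF \<kappa>])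
    show "0 \<le> f u" if "0 < u" "u \<le> \<kappa>" for u
    proof -
      have "0 \<le> (r - 1) / 2 * avg u powr r" using r by simp
      then show ?thesis using f_ge[of u] that by simp
    qed
    show "(f has_integral (g \<kappa> - g \<epsilon>)) {\<epsilon>..\<kappa>}" if \<epsilon>: "0 < \<epsilon>" "\<epsilon> < \<kappa>" for \<epsilon>
    proof -
      have "J \<epsilon> + integral {\<epsilon>..\<kappa>} (\<lambda>v. h v powr r) = J \<kappa>"
        unfolding J_def using \<epsilon> intJ by (intro Henstock_Kurzweil_Integration.integral_combine) auto
      moreover have "(\<lambda>v. h v powr r) integrable_on {\<epsilon>..\<kappa>}"
        using \<epsilon> by (intro integrable_on_subinterval[OF intJ]) auto
      ultimately have "((\<lambda>v. h v powr r) has_integral (J \<kappa> - J \<epsilon>)) {\<epsilon>..\<kappa>}"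
        by (metis add_diff_cancel_left' has_integral_integrable_integral)
      then have "(f has_integral (C * (J \<kappa> - J \<epsilon>) - (\<kappa> * avg \<kappa> powr r - \<epsilon> * avg \<epsilon> powr r))) {\<epsilon>..\<kappa>}"
        unfolding f_def by (intro has_integral_diff has_integral_mult_right hardy_FTC r \<epsilon>)
      then show ?thesis by (simp add: g_def algebra_simps)
    qed
    have "continuous_on {0..\<kappa>} J"
      unfolding J_def by (rule indefinite_integral_continuous_1[OF intJ])
    then have "(J \<longlongrightarrow> J 0) (at 0 within {0..\<kappa>})" using \<kappa> by (simp add: continuous_on_def)
    then have J0: "(J \<longlongrightarrow> 0) (at_right 0)" using \<kappa> by (simp add: J_def at_within_Icc_at_right)
    have near: "\<forall>\<^sub>F u in at_right 0. u \<in> {0<..<\<kappa>}" by (rule eventually_at_right_real[OF \<kappa>])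
    \<comment> \<open>The boundary term is squeezed between 0 and \<open>J u\<close> by Jensen's
      inequality.\<close>
    have "((\<lambda>u. u * avg u powr r) \<longlongrightarrow> 0) (at_right 0)"
    proof (rule tendsto_sandwich[OF _ _ tendsto_const J0])
      show "\<forall>\<^sub>F u in at_right 0. 0 \<le> u * avg u powr r"
        using near by eventually_elim auto
      show "\<forall>\<^sub>F u in at_right 0. u * avg u powr r \<le> J u"
        using near
      proof eventually_elim
        case (elim u)
        then have "set_integrable lborel {0<..u} (\<lambda>v. h v powr r)"
          by (intro set_integrable_subset[OF int]) auto
        from set_integral_Ioc_eq_integral_Icc[OF this] show ?case
          using powr_set_integral_ge[OF r int, of u] elim by (simp add: J_def)
      qed
    qed
    then have "(g \<longlongrightarrow> C * 0 - 0) (at_right 0)"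
      unfolding g_def by (intro tendsto_intros J0)
    then show "(g \<longlongrightarrow> 0) (at_right 0)" by simp
  qed
  then have f: "(f has_integral g \<kappa>) {0<..\<kappa>}" by simp
  have f_int: "set_integrable lborel {0<..\<kappa>} f"
  proof (rule set_integrable_lborel_nonneg)
    show "f integrable_on {0<..\<kappa>}" using f by blast
    show "f \<in> borel_measurable (restrict_space borel {0<..\<kappa>})" unfolding f_def by measurable
    show "0 \<le> f u" if "u \<in> {0<..\<kappa>}" for u
    proof -
      have "0 \<le> (r - 1) / 2 * avg u powr r" using r by simp
      then show ?thesis using f_ge[OF that] by simp
    qed
  qed simp
  show 1: "set_integrable lborel {0<..\<kappa>} (\<lambda>u. avg u powr r)"
  proof (rule set_integrable_dominated)
    show "set_integrable lborel {0<..\<kappa>} (\<lambda>u. 2 / (r - 1) * f u)" using f_int by simp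
    show "(\<lambda>u. avg u powr r) \<in> borel_measurable (restrict_space borel {0<..\<kappa>})" by measurable
    show "\<bar>avg u powr r\<bar> \<le> 2 / (r - 1) * f u" if "u \<in> {0<..\<kappa>}" for u
      using f_ge[OF that] r by (simp add: field_simps)
  qed auto
  show 2: "set_integrable lborel {0<..\<kappa>} (\<lambda>u. avg u powr (r - 1) * h u)"
  proof (rule set_integrable_dominated[OF 1])
    show "(\<lambda>u. avg u powr (r - 1) * h u) \<in> borel_measurable (restrict_space borel {0<..\<kappa>})" by measurable
    show "\<bar>avg u powr (r - 1) * h u\<bar> \<le> avg u powr r" if "u \<in> {0<..\<kappa>}" for u
    proof -
      have "avg u powr (r - 1) * h u \<le> avg u powr (r - 1) * avg u"
        using h_le_avg that by (intro mult_left_mono) auto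
      also have "\<dots> = avg u powr r"
        using powr_mult_base[of "avg u" "r - 1"] avg_pos[of u] that by (simp add: mult.commute)
      finally show ?thesis using h_nonneg[OF that] by simp
    qed
  qed auto
  \<comment> \<open>Evaluating the integral of \<open>f\<close> in two ways cancels the auxiliary
    term \<open>C * J \<kappa>\<close> and leaves the identity.\<close>
  have "g \<kappa> = (LBINT u:{0<..\<kappa>}. f u)"
    using set_borel_integral_eq_integral(2)[OF f_int] integral_unique[OF f] by simp
  also have "\<dots> = C * (LBINT u:{0<..\<kappa>}. h u powr r) - (r * (LBINT u:{0<..\<kappa>}. avg u powr (r - 1) * h u)
      - (r - 1) * (LBINT u:{0<..\<kappa>}. avg u powr r))"
    unfolding f_def using 1 2 int by (simp add: set_integral_diff)
  also have "(LBINT u:{0<..\<kappa>}. h u powr r) = J \<kappa>"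
    unfolding J_def by (rule set_integral_Ioc_eq_integral_Icc[OF int])
  finally show "(r - 1) * (LBINT u:{0<..\<kappa>}. avg u powr r) + \<kappa> * avg \<kappa> powr r
      = r * (LBINT u:{0<..\<kappa>}. avg u powr (r - 1) * h u)"
    by (simp add: g_def)
qed

section \<open>Bounds for the power integrals of the averages\<close>

lemma avg_powr_ge_h_powr:
  assumes "0 < r" "u \<in> {0<..\<kappa>}"
  shows "h u powr r \<le> avg u powr r"
  using assms h_nonneg h_le_avg by (intro powr_mono2) auto

text \<open>Hoelder's inequality bounds the mixed integral \<open>X\<close> by
  \<open>y * W powr (r - 1)\<close>. Inserted into the Hardy identity, this reads
  \<open>c \<le> H r W\<close>, and \<open>H r\<close> is decreasing.\<close>

lemma avg_powr_integral_le_omega: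
  assumes r: "1 < r" and int: "set_integrable lborel {0<..\<kappa>} (\<lambda>u. h u powr r)"
    and y: "y = (LBINT u:{0<..\<kappa>}. h u powr r)" "0 < y"
    and c: "c * y = \<kappa> * avg \<kappa> powr r" "0 \<le> c" "c \<le> 1"
  shows "(LBINT u:{0<..\<kappa>}. avg u powr r) \<le> y * omega r c powr r"
proof -
  define K where "K = (LBINT u:{0<..\<kappa>}. avg u powr r)"
  define X where "X = (LBINT u:{0<..\<kappa>}. avg u powr (r - 1) * h u)"
  note ints = avg_powr_integrable[OF r int] avg_powr_mult_integrable[OF r int]
  have "y \<le> K"
    unfolding y K_def using r by (intro set_integral_mono int ints avg_powr_ge_h_powr) auto
  \<comment> \<open>With this \<open>W\<close>, \<open>(avg u / W) powr r\<close> has the same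
    integral \<open>y\<close> as \<open>h u powr r\<close>, so the integrated Young inequality is
    exactly Hoelder's.\<close>
  define W where "W = (K / y) powr (1 / r)"
  have W: "1 \<le> W" using \<open>y \<le> K\<close> y r unfolding W_def by (intro ge_one_powr_ge_zero) auto
  have Wr: "W powr r = K / y" using \<open>y \<le> K\<close> y r by (simp add: W_def powr_powr)
  define V where "V = W powr (r - 1)"
  have "V > 0" using W by (simp add: V_def)
  have "r * (1 / V) * X \<le> y + (r - 1) * (y / K) * K"
  proof -
    have "(LBINT u:{0<..\<kappa>}. r * (1 / V) * (avg u powr (r - 1) * h u))
        \<le> (LBINT u:{0<..\<kappa>}. h u powr r + (r - 1) * (y / K) * avg u powr r)"
    proof (rule set_integral_mono)
      show "r * (1 / V) * (avg u powr (r - 1) * h u) \<le> h u powr r + (r - 1) * (y / K) * avg u powr r"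
        if u: "u \<in> {0<..\<kappa>}" for u
      proof -
        have "r * h u * (avg u / W) powr (r - 1) \<le> h u powr r + (r - 1) * (avg u / W) powr r"
          using u W avg_pos[of u] by (intro young_powr r h_nonneg) auto
        moreover have "(avg u / W) powr (r - 1) = avg u powr (r - 1) / V"
          "(avg u / W) powr r = avg u powr r * (y / K)"
          using u W avg_pos[of u] by (simp_all add: powr_divide V_def Wr)
        ultimately show ?thesis by (simp add: mult_ac)
      qed
    qed (use int ints in \<open>auto intro: set_integral_add(1)\<close>)
    then show ?thesis
      using int ints by (subst (asm) set_integral_add(2)) (auto simp: X_def K_def y(1))
  qed
  also have "\<dots> = r * y" using y \<open>y \<le> K\<close> by (simp add: field_simps)
  finally have "r * X \<le> r * y * V" using \<open>V > 0\<close> by (simp add: field_simps)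
  moreover have "(r - 1) * K + c * y = r * X"
    using hardy_identity[OF r int] c(1) unfolding K_def X_def by simp
  moreover have "K = W powr r * y" using Wr y by simp
  ultimately have "c * y \<le> (r * V - (r - 1) * W powr r) * y" by (simp add: algebra_simps)
  then have "c \<le> H r W" using y by (simp add: H_def V_def)
  then have "W \<le> omega r c" by (rule le_omega[OF r c(2,3) W])
  then have "W powr r \<le> omega r c powr r" using W r by (intro powr_mono2) auto
  then have "y * W powr r \<le> y * omega r c powr r" using y by simp
  then show ?thesis using Wr y by (simp add: K_def)
qed

text \<open>The weighted Young inequality \<open>main\<close> becomes a bound on \<open>I\<close>
  once the Hardy identities eliminate the mixed integrals. In that bound
  \<open>Z - \<mu> * y\<close> and \<open>K\<close> have nonnegative coefficients, so the upper
  bounds for \<open>Z\<close> and \<open>K\<close> may be inserted; dividing by \<open>z\<close>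
  yields \<open>level\<close>.\<close>

lemma level_avg_nonpos:
  assumes q: "1 < q" and pq: "q < p" and b: "0 \<le> \<beta>"
    and int: "set_integrable lborel {0<..\<kappa>} (\<lambda>u. h u powr p)"
    and z: "z = (LBINT u:{0<..\<kappa>}. h u powr p)" "0 < z"
    and y: "y = (LBINT u:{0<..\<kappa>}. h u powr q)" "0 < y"
    and s1: "s1 * z = \<kappa> * avg \<kappa> powr p"
    and s2: "s2 * y = \<kappa> * avg \<kappa> powr q" "s2 \<le> 1"
    and t: "0 < t" "t powr p * z = (LBINT u:{0<..\<kappa>}. avg u powr p)"
  shows "level p q s1 s2 \<beta> t \<le> 0"
proof -
  have p: "1 < p" using q pq by simp
  have int_q: "set_integrable lborel {0<..\<kappa>} (\<lambda>u. h u powr q)"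
    by (rule set_integrable_powr_le[OF _ _ _ int]) (use q pq h_nonneg in auto)
  note ip = avg_powr_integrable[OF p int] avg_powr_mult_integrable[OF p int]
  note iq = avg_powr_integrable[OF q int_q] avg_powr_mult_integrable[OF q int_q]
  define m where "m = avg \<kappa>"
  have m: "0 < m" using avg_pos[of \<kappa>] \<kappa> by (simp add: m_def)
  \<comment> \<open>\<open>\<mu>\<close> is the least value of \<open>avg u powr (p - q)\<close>.
    Since \<open>\<mu> * m powr q = m powr p\<close>, it also ties the two boundary terms together:
    \<open>\<mu> * (s2 * y) = s1 * z\<close>.\<close>
  define \<mu> where "\<mu> = m powr (p - q)"
  have mu_m: "\<mu> * m powr q = m powr p" by (simp add: \<mu>_def flip: powr_add)
  have "0 < \<mu>" using m by (simp add: \<mu>_def)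
  define I where "I = (LBINT u:{0<..\<kappa>}. avg u powr p)"
  define K where "K = (LBINT u:{0<..\<kappa>}. avg u powr q)"
  define Xp where "Xp = (LBINT u:{0<..\<kappa>}. avg u powr (p - 1) * h u)"
  define Xq where "Xq = (LBINT u:{0<..\<kappa>}. avg u powr (q - 1) * h u)"
  define Z where "Z = (LBINT u:{0<..\<kappa>}. avg u powr (p - q) * h u powr q)"
  define B where "B = \<beta> + 1"
  have B: "1 \<le> B" using b by (simp add: B_def)
  have iz: "set_integrable lborel {0<..\<kappa>} (\<lambda>u. avg u powr (p - q) * h u powr q)"
  proof (rule set_integrable_dominated[OF ip(1)])
    show "\<bar>avg u powr (p - q) * h u powr q\<bar> \<le> avg u powr p" if "u \<in> {0<..\<kappa>}" for u
    proof -
      have "avg u powr (p - q) * h u powr q \<le> avg u powr (p - q) * avg u powr q"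
        using that q by (intro mult_left_mono avg_powr_ge_h_powr) auto
      then show ?thesis by (simp flip: powr_add)
    qed
    show "(\<lambda>u. avg u powr (p - q) * h u powr q) \<in> borel_measurable (restrict_space borel {0<..\<kappa>})"
      by measurable
  qed auto
  have Kle: "K \<le> y * omega q s2 powr q"
  proof -
    have "0 \<le> s2 * y" using s2(1) \<kappa> by simp
    then have "0 \<le> s2" using y(2) by (simp add: zero_le_mult_iff)
    then show ?thesis
      unfolding K_def using s2 by (intro avg_powr_integral_le_omega q int_q y) auto
  qed
  \<comment> \<open>Hoelder's inequality in the form of Young's inequality for \<open>avg u / t\<close> and \<open>h u\<close>\<close>
  have Zle: "Z \<le> t powr (p - q) * z"
  proof -
    have "(LBINT u:{0<..\<kappa>}. p / t powr (p - q) * (avg u powr (p - q) * h u powr q))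
        \<le> (LBINT u:{0<..\<kappa>}. (p - q) / t powr p * avg u powr p + q * h u powr p)"
    proof (rule set_integral_mono)
      show "p / t powr (p - q) * (avg u powr (p - q) * h u powr q)
          \<le> (p - q) / t powr p * avg u powr p + q * h u powr p" if "u \<in> {0<..\<kappa>}" for u
        using young_powr_diff[of q p "avg u / t" "h u"] q pq t(1) avg_pos[of u] h_nonneg[of u] that
        by (simp add: powr_divide)
    qed (use iz ip int in \<open>auto intro: set_integral_add(1)\<close>)
    then have "p / t powr (p - q) * Z \<le> (p - q) / t powr p * I + q * z"
      using iz ip int by (subst (asm) set_integral_add(2)) (auto simp: Z_def I_def z(1))
    also have "\<dots> = p * z"
      using t unfolding I_def[symmetric] by (simp add: field_simps flip: t(2))
    finally show ?thesis using p t by (simp add: field_simps)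
  qed
  \<comment> \<open>Young's inequality, weighted with \<open>avg u powr (p - q) - \<mu>\<close>; the weight is nonnegative since
    \<open>avg\<close> is decreasing. Splitting off \<open>\<mu>\<close> is what brings in the integral \<open>K\<close>.\<close>
  have main: "q * B * (Xp - \<mu> * Xq) \<le> B powr q * (Z - \<mu> * y) + (q - 1) * (I - \<mu> * K)"
  proof -
    have "(LBINT u:{0<..\<kappa>}. q * B * (avg u powr (p - 1) * h u - \<mu> * (avg u powr (q - 1) * h u)))
       \<le> (LBINT u:{0<..\<kappa>}. B powr q * (avg u powr (p - q) * h u powr q - \<mu> * h u powr q)
            + (q - 1) * (avg u powr p - \<mu> * avg u powr q))"
    proof (rule set_integral_mono)
      show "q * B * (avg u powr (p - 1) * h u - \<mu> * (avg u powr (q - 1) * h u))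
        \<le> B powr q * (avg u powr (p - q) * h u powr q - \<mu> * h u powr q)
            + (q - 1) * (avg u powr p - \<mu> * avg u powr q)" if u: "u \<in> {0<..\<kappa>}" for u
      proof -
        define w where "w = avg u powr (p - q) - \<mu>"
        have "0 \<le> w"
          using avg_ge[of u] u m pq by (auto simp: w_def \<mu>_def m_def intro: powr_mono2)
        have "q * (B * h u) * avg u powr (q - 1) \<le> (B * h u) powr q + (q - 1) * avg u powr q"
          using u B h_nonneg[OF u] avg_pos[of u] by (intro young_powr q) auto
        then have "w * (q * (B * h u) * avg u powr (q - 1)) \<le> w * ((B * h u) powr q + (q - 1) * avg u powr q)"
          using \<open>0 \<le> w\<close> by (rule mult_left_mono)
        moreover have "avg u powr (p - 1) = avg u powr (p - q) * avg u powr (q - 1)"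
          "avg u powr p = avg u powr (p - q) * avg u powr q"
          by (simp_all flip: powr_add)
        moreover have "(B * h u) powr q = B powr q * h u powr q"
          using B h_nonneg[OF u] by (simp add: powr_mult)
        ultimately show ?thesis unfolding w_def by (simp add: algebra_simps)
      qed
    qed (use iz ip iq int_q in \<open>auto intro!: set_integral_add(1) set_integral_diff(1)\<close>)
    then show ?thesis
      using iz ip iq int_q
      by (simp add: set_integral_add set_integral_diff Xp_def Xq_def Z_def I_def K_def y(1))
  qed
  have Xp: "p * Xp = (p - 1) * I + s1 * z"
    using hardy_identity[OF p int] s1 by (simp add: Xp_def I_def)
  have Xq: "q * Xq = (q - 1) * K + s2 * y"
    using hardy_identity[OF q int_q] s2 by (simp add: Xq_def K_def)
  have mus: "\<mu> * (s2 * y) = s1 * z"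
    unfolding s1 s2(1) using mu_m by (simp add: m_def algebra_simps)
  \<comment> \<open>The coefficient of \<open>I\<close> is
    \<open>q * B * (p - 1) - p * (q - 1)\<close>, which is \<open>G p q \<beta>\<close>; that of
    \<open>\<mu> * K\<close> reduces to a multiple of \<open>B - 1 = \<beta>\<close>; and the
    boundary terms merge through \<open>mus\<close>.\<close>
  have "G p q \<beta> * I - p * B powr q * (Z - \<mu> * y) - (p - q) * B * (s1 * z) - p * (q - 1) * \<beta> * (\<mu> * K)
      = q * B * (p * Xp) - p * B * \<mu> * (q * Xq) - p * B powr q * (Z - \<mu> * y) - p * (q - 1) * (I - \<mu> * K)"
    unfolding Xp Xq G_def B_def by (simp add: algebra_simps flip: mus)
  also have "\<dots> = p * (q * B * (Xp - \<mu> * Xq) - (B powr q * (Z - \<mu> * y) + (q - 1) * (I - \<mu> * K)))"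
    by (simp add: algebra_simps)
  also have "\<dots> \<le> 0" using main p by (simp add: mult_le_0_iff)
  finally have 1: "G p q \<beta> * I \<le> p * B powr q * (Z - \<mu> * y) + (p - q) * B * (s1 * z) + p * (q - 1) * \<beta> * (\<mu> * K)"
    by simp
  also have "\<dots> \<le> p * B powr q * (t powr (p - q) * z - \<mu> * y) + (p - q) * B * (s1 * z)
      + p * (q - 1) * \<beta> * (\<mu> * (y * omega q s2 powr q))"
    using Zle Kle p q b \<open>0 < \<mu>\<close> by (intro add_mono mult_left_mono order_refl) auto
  finally have 2: "G p q \<beta> * I \<le> p * B powr q * (t powr (p - q) * z - \<mu> * y) + (p - q) * B * (s1 * z)
      + p * (q - 1) * \<beta> * (\<mu> * (y * omega q s2 powr q))" .
  define \<rho> where "\<rho> = s1 / s2"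
  have mu_y: "\<mu> * y = \<rho> * z"
  proof -
    have "0 < s2 * y" unfolding s2(1) using \<kappa> m by (simp add: m_def)
    then have "s2 \<noteq> 0" by auto
    then show ?thesis using mus by (simp add: \<rho>_def field_simps)
  qed
  have "z * level p q s1 s2 \<beta> t = G p q \<beta> * I - p * B powr q * (t powr (p - q) * z - \<rho> * z)
      - (p - q) * B * (s1 * z) - p * (q - 1) * \<beta> * (\<rho> * z * omega q s2 powr q)"
    unfolding level_def I_def t(2)[symmetric] B_def
    by (fold \<rho>_def) (simp add: algebra_simps)
  also have "\<dots> \<le> 0" using 2 unfolding mult.assoc[symmetric, of \<mu> y] mu_y by simp
  finally have "z * level p q s1 s2 \<beta> t \<le> 0" .
  then show ?thesis using z(2) by (simp add: mult_le_0_iff)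
qed

end

subsection \<open>The sharp constant\<close>

text \<open>For the second equivalence, \<open>(p - 1) * e = q - 1\<close> and
  \<open>p * e + f = q\<close> give \<open>s1 powr e\<close> and \<open>s2\<close> the common factor
  \<open>P / \<kappa> powr (q - 1)\<close>, which cancels.\<close>

lemma parameters_iff:
  fixes p q \<kappa> x y z s1 s2 :: real
  assumes "1 < q" "q < p" "0 < \<kappa>" "0 < x" "0 < y" "0 < z"
    and s1: "s1 = x powr p / (\<kappa> powr (p - 1) * z)"
    and s2: "s2 = x powr q / (\<kappa> powr (q - 1) * y)"
  shows "x powr q / \<kappa> powr (q - 1) < y \<longleftrightarrow> s2 < 1"
    and "y \<le> x powr ((p - q) / (p - 1)) * z powr ((q - 1) / (p - 1)) \<longleftrightarrow> s1 powr ((q - 1) / (p - 1)) \<le> s2"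
proof -
  show "x powr q / \<kappa> powr (q - 1) < y \<longleftrightarrow> s2 < 1"
    using assms by (simp add: s2 field_simps)
  define e where "e = (q - 1) / (p - 1)"
  define f where "f = (p - q) / (p - 1)"
  have e: "(p - 1) * e = q - 1" using assms by (simp add: e_def)
  have ef: "p * e + f = q"
  proof -
    have "p * (q - 1) + (p - q) = q * (p - 1)" by (simp add: algebra_simps)
    then have "p * e + f = q * (p - 1) / (p - 1)"
      unfolding e_def f_def by (metis add_divide_distrib times_divide_eq_right)
    then show ?thesis using assms by simp
  qed
  define P where "P = x powr (p * e)"
  have "0 < P" using assms by (simp add: P_def)
  have "s1 powr e = P / (\<kappa> powr (q - 1) * z powr e)"
    using assms by (simp add: s1 powr_divide powr_mult powr_powr e P_def)
  moreover have "s2 = P * x powr f / (\<kappa> powr (q - 1) * y)"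
    by (simp add: s2 P_def ef flip: powr_add)
  moreover have "P / (\<kappa> powr (q - 1) * z powr e) \<le> P * x powr f / (\<kappa> powr (q - 1) * y)
      \<longleftrightarrow> y \<le> x powr f * z powr e"
    using \<open>0 < P\<close> assms(3,5,6) by (simp add: field_simps)
  ultimately have "s1 powr e \<le> s2 \<longleftrightarrow> y \<le> x powr f * z powr e" by simp
  then show "y \<le> x powr ((p - q) / (p - 1)) * z powr ((q - 1) / (p - 1)) \<longleftrightarrow> s1 powr ((q - 1) / (p - 1)) \<le> s2"
    by (simp add: e_def f_def)
qed

lemma (in parameters) avg_powr_integral_le_t_max:
  fixes h :: "real \<Rightarrow> real"
  assumes "0 < \<kappa>" "0 < x" "0 < y" "0 < z"
    and s1: "s1 = x powr p / (\<kappa> powr (p - 1) * z)"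
    and s2: "s2 = x powr q / (\<kappa> powr (q - 1) * y)"
    and nonneg: "\<And>u. u \<in> {0<..\<kappa>} \<Longrightarrow> 0 \<le> h u"
    and anti: "antimono_on {0<..\<kappa>} h"
    and int: "set_integrable lborel {0<..\<kappa>} (\<lambda>u. h u powr p)"
    and x: "(LBINT u:{0<..\<kappa>}. h u) = x"
    and y: "(LBINT u:{0<..\<kappa>}. h u powr q) = y"
    and z: "(LBINT u:{0<..\<kappa>}. h u powr p) = z"
  shows "set_integrable lborel {0<..\<kappa>} (\<lambda>u. (1 / u * (LBINT v:{0<..u}. h v)) powr p)"
    and "(LBINT u:{0<..\<kappa>}. (1 / u * (LBINT v:{0<..u}. h v)) powr p) \<le> t_max p q s1 s2 powr p * z"
proof -
  have p: "1 < p" using q pq by simp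
  have "set_integrable lborel {0<..\<kappa>} (\<lambda>u. h u powr 1)"
    by (rule set_integrable_powr_le[OF _ _ _ int]) (use p nonneg in auto)
  also have "?this \<longleftrightarrow> set_integrable lborel {0<..\<kappa>} h"
    by (intro set_integrable_cong) (use nonneg in auto)
  finally have "set_integrable lborel {0<..\<kappa>} h" .
  then interpret decreasing_function h \<kappa>
    using assms by unfold_locales auto
  \<comment> \<open>For \<open>r = p\<close> and \<open>r = q\<close> this identifies
    \<open>s1 * z\<close> and \<open>s2 * y\<close> with the boundary terms of the Hardy
    identities.\<close>
  have avg_\<kappa>: "\<kappa> * avg \<kappa> powr r = x powr r / \<kappa> powr (r - 1)" for r
    using assms powr_mult_base[of \<kappa> "r - 1"] by (simp add: avg_def x powr_divide field_simps)
  note ip = avg_powr_integrable[OF p int]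
  define I where "I = (LBINT u:{0<..\<kappa>}. avg u powr p)"
  have "z \<le> I"
    unfolding I_def z[symmetric] using p by (intro set_integral_mono int ip avg_powr_ge_h_powr) auto
  define t where "t = (I / z) powr (1 / p)"
  have t: "1 \<le> t" unfolding t_def using \<open>z \<le> I\<close> \<open>0 < z\<close> p by (intro ge_one_powr_ge_zero) auto
  have tp: "t powr p * z = I" using \<open>z \<le> I\<close> \<open>0 < z\<close> p by (simp add: t_def powr_powr)
  have "t \<le> t_max p q s1 s2"
  proof (rule le_t_max[OF t])
    fix \<beta> :: real assume "0 \<le> \<beta>"
    then show "level p q s1 s2 \<beta> t \<le> 0"
      by (rule level_avg_nonpos[OF q pq _ int, where y = y and z = z])
        (use t tp I_def assms(1-6) s2_less x y z in \<open>auto simp: avg_\<kappa>\<close>)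
  qed
  then have "t powr p \<le> t_max p q s1 s2 powr p" using t p by (intro powr_mono2) auto
  then have "I \<le> t_max p q s1 s2 powr p * z" using \<open>0 < z\<close> by (simp flip: tp)
  then show "(LBINT u:{0<..\<kappa>}. (1 / u * (LBINT v:{0<..u}. h v)) powr p) \<le> t_max p q s1 s2 powr p * z"
    by (simp add: I_def avg_def)
  show "set_integrable lborel {0<..\<kappa>} (\<lambda>u. (1 / u * (LBINT v:{0<..u}. h v)) powr p)"
    using ip by (simp add: avg_def)
qed

text \<open>Integrability is asserted along with the bound because \<open>LBINT\<close> of a
  non-integrable function is 0 by default. Similarly, membership and maximality in
  \<open>admissible_t\<close> certify that \<open>GREATEST\<close> denotes an actual greatest
  element.\<close>

theorem mainTheorem1:
  fixes p q \<kappa> x y z s1 s2 :: real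
  assumes "1 < q" and "q < p"
    and "0 < \<kappa>" and "\<kappa> \<le> 1"
    and "0 < x" and "0 < y" and "0 < z"
    and s1: "s1 = x powr p / (\<kappa> powr (p - 1) * z)"
    and s2: "s2 = x powr q / (\<kappa> powr (q - 1) * y)"
  shows
    "((0 < x powr q / \<kappa> powr (q - 1) \<and> x powr q / \<kappa> powr (q - 1) < y \<and>
       y \<le> x powr ((p - q) / (p - 1)) * z powr ((q - 1) / (p - 1)))
      \<longleftrightarrow>
      (0 < s1 powr ((q - 1) / (p - 1)) \<and> s1 powr ((q - 1) / (p - 1)) \<le> s2 \<and> s2 < 1))
     \<and>
     ((0 < x powr q / \<kappa> powr (q - 1) \<and> x powr q / \<kappa> powr (q - 1) < y \<and>
       y \<le> x powr ((p - q) / (p - 1)) * z powr ((q - 1) / (p - 1)))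
      \<longrightarrow>
      (t_max p q s1 s2 \<in> admissible_t p q s1 s2 \<and>
       (\<forall>t \<in> admissible_t p q s1 s2. t \<le> t_max p q s1 s2)) \<and>
      (\<forall>h :: real \<Rightarrow> real.
         (\<forall>u \<in> {0<..\<kappa>}. 0 \<le> h u) \<and>
         antimono_on {0<..\<kappa>} h \<and>
         set_integrable lborel {0<..\<kappa>} (\<lambda>u. h u powr p) \<and>
         (LBINT u:{0<..\<kappa>}. h u) = x \<and>
         (LBINT u:{0<..\<kappa>}. h u powr q) = y \<and>
         (LBINT u:{0<..\<kappa>}. h u powr p) = z
         \<longrightarrow>
         set_integrable lborel {0<..\<kappa>} (\<lambda>u. (1 / u * (LBINT v:{0<..u}. h v)) powr p) \<and>
         (LBINT u:{0<..\<kappa>}. (1 / u * (LBINT v:{0<..u}. h v)) powr p)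
           \<le> t_max p q s1 s2 powr p * (LBINT u:{0<..\<kappa>}. h u powr p)) \<and>
      (t_max p q s1 s2 \<in> t_beta p q s1 s2 ` {0..1 / (p - 1)} \<and>
       (\<forall>\<beta> \<in> {0..1 / (p - 1)}. t_max p q s1 s2 \<le> t_beta p q s1 s2 \<beta>)))"
    (is "(?A \<longleftrightarrow> ?B) \<and> (?A \<longrightarrow> ?C)")
proof (rule conjI)
  have pos: "0 < s1" "0 < x powr q / \<kappa> powr (q - 1)" using assms by simp_all
  note iff = parameters_iff[OF assms(1-3,5-7) s1 s2]
  show AB: "?A \<longleftrightarrow> ?B" using iff pos by auto
  show "?A \<longrightarrow> ?C"
  proof
    assume ?A
    then interpret parameters p q s1 s2
      using iff pos assms(1,2) by unfold_locales auto
    show ?C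
    proof (intro conjI allI impI ballI)
      fix h :: "real \<Rightarrow> real"
      assume h: "(\<forall>u \<in> {0<..\<kappa>}. 0 \<le> h u) \<and> antimono_on {0<..\<kappa>} h \<and>
         set_integrable lborel {0<..\<kappa>} (\<lambda>u. h u powr p) \<and>
         (LBINT u:{0<..\<kappa>}. h u) = x \<and> (LBINT u:{0<..\<kappa>}. h u powr q) = y \<and>
         (LBINT u:{0<..\<kappa>}. h u powr p) = z"
      note avg = avg_powr_integral_le_t_max[OF assms(3,5-7) s1 s2, of h]
      show "set_integrable lborel {0<..\<kappa>} (\<lambda>u. (1 / u * (LBINT v:{0<..u}. h v)) powr p)"
        by (rule avg) (use h in auto)
      have "(LBINT u:{0<..\<kappa>}. (1 / u * (LBINT v:{0<..u}. h v)) powr p) \<le> t_max p q s1 s2 powr p * z"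
        by (rule avg) (use h in auto)
      then show "(LBINT u:{0<..\<kappa>}. (1 / u * (LBINT v:{0<..u}. h v)) powr p)
           \<le> t_max p q s1 s2 powr p * (LBINT u:{0<..\<kappa>}. h u powr p)"
        using h by simp
    qed (use t_max_admissible t_max_greatest t_max_attained t_max_le in auto)
  qed
qed

end
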